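(* Let $\mathfrak{g}$ be a Lie algebra which is not M-decomposed. Then there exists a Lie subalgebra $\mathfrak{h}$ of $\mathfrak{g}$ which is isomorphic to $\mathfrak{sl}_2\ltimes\mathfrak{v}_n$ or $\mathfrak{sl}_2\ltimes\mathfrak{h}_{2n-1}$ for some $n\ge2$.
   Context: All Lie algebras are finite-dimensional over a field $K$ of characteristic zero; $\mathfrak{sl}_2=\mathfrak{sl}_2(K)$. Let $\mathfrak{r}$ be the radical of $\mathfrak{g}$ and $\mathfrak{s}$ a semisimple Levi factor, so $\mathfrak{g}\simeq\mathfrak{s}\ltimes\mathfrak{r}$. Write $\mathfrak{s}=\mathfrak{s}_c\oplus\mathfrak{s}_{nc}$, where $\mathfrak{s}_c$ is the sum of the $K$-anisotropic simple factors and $\mathfrak{s}_{nc}$ the sum of the $K$-isotropic simple factors (those of $K$-rank $\ge 1$). $\mathfrak{g}$ is called M-decomposed if $[\mathfrak{s}_{nc},\mathfrak{r}]=0$; equivalently, the amenable radical $\mathfrak{s}_c\ltimes\mathfrak{r}$ is a direct factor of $\mathfrak{g}$. For $n\ge1$, $\mathfrak{v}_n$ denotes the $n$-dimensional irreducible $\mathfrak{sl}_2$-module (unique up to isomorphism), viewed as an abelian Lie algebra with $\mathfrak{sl}_2$-action. For $m\ge1$, $\mathfrak{h}_{2m+1}$ denotes the Heisenberg Lie algebra $\mathfrak{v}_{2m}\oplus K$ with bracket $[(x,a),(y,b)]=(0,\varphi(x,y))$, $\varphi$ a nonzero $\mathfrak{sl}_2$-invariant alternating bilinear form on $\mathfrak{v}_{2m}$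 (unique up to scalar), with $\mathfrak{sl}_2$-action $[s,(x,a)]=([s,x],0)$. *)

theory Defs
  imports "HOL-Analysis.Determinants" "HOL-Library.Function_Algebras"
begin

section \<open>Lie algebras\<close>

text \<open>The ambient Lie algebra is the whole type \<^typ>\<open>'v\<close>; subalgebras, ideals, Levi factors and so on
  are subsets of it, and the notions below are relative to such a subset \<open>S\<close>.\<close>

locale lie_algebra = vector_space smul
  for smul :: "'k::field \<Rightarrow> 'v::ab_group_add \<Rightarrow> 'v" (infixr \<open>*s\<close> 75) +
  fixes bracket :: "'v \<Rightarrow> 'v \<Rightarrow> 'v"
  assumes bracket_add_left: "bracket (x + y) z = bracket x z + bracket y z"
    and bracket_add_right: "bracket x (y + z) = bracket x y + bracket x z"
    and bracket_scale_left: "bracket (c *s x) y = c *s bracket x y"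
    and bracket_scale_right: "bracket x (c *s y) = c *s bracket x y"
    and bracket_self: "bracket x x = 0"
    and jacobi: "bracket x (bracket y z) + bracket y (bracket z x) + bracket z (bracket x y) = 0"
begin

definition subalgebra :: "'v set \<Rightarrow> bool" where
  "subalgebra S \<longleftrightarrow> subspace S \<and> (\<forall>x\<in>S. \<forall>y\<in>S. bracket x y \<in> S)"

definition ideal_of :: "'v set \<Rightarrow> 'v set \<Rightarrow> bool" where
  "ideal_of I S \<longleftrightarrow> subspace I \<and> I \<subseteq> S \<and> (\<forall>x\<in>S. \<forall>y\<in>I. bracket x y \<in> I)"

definition bracket_span :: "'v set \<Rightarrow> 'v set \<Rightarrow> 'v set" where
  "bracket_span A B = span {bracket x y | x y. x \<in> A \<and> y \<in> B}"

definition abelian :: "'v set \<Rightarrow> bool" where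
  "abelian S \<longleftrightarrow> (\<forall>x\<in>S. \<forall>y\<in>S. bracket x y = 0)"

definition solvable :: "'v set \<Rightarrow> bool" where
  "solvable S \<longleftrightarrow> (\<exists>n. ((\<lambda>D. bracket_span D D) ^^ n) S = {0})"

text \<open>The sum of all solvable ideals, which in finite dimension is the largest one.\<close>

definition radical :: "'v set \<Rightarrow> 'v set" where
  "radical S = span (\<Union>{I. ideal_of I S \<and> solvable I})"

definition semisimple :: "'v set \<Rightarrow> bool" where
  "semisimple S \<longleftrightarrow> subalgebra S \<and> radical S = {0}"

definition simple :: "'v set \<Rightarrow> bool" where
  "simple S \<longleftrightarrow> subalgebra S \<and> \<not> abelian S \<and> (\<forall>I. ideal_of I S \<longrightarrow> I = {0} \<or> I = S)"

definition levi_factor :: "'v set \<Rightarrow> bool" where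
  "levi_factor s \<longleftrightarrow> semisimple s \<and> s \<inter> radical UNIV = {0} \<and>
     {x + y | x y. x \<in> s \<and> y \<in> radical UNIV} = UNIV"

text \<open>The \<open>K\<close>-rank of a semisimple \<open>S\<close> is the largest dimension of a subalgebra whose adjoint action
  on \<open>S\<close> is simultaneously diagonalizable over the ground field itself.\<close>

definition split_torus :: "'v set \<Rightarrow> 'v set \<Rightarrow> bool" where
  "split_torus T S \<longleftrightarrow> subalgebra T \<and> T \<subseteq> S \<and> abelian T \<and>
     (\<exists>B. independent B \<and> span B = S \<and> (\<forall>t\<in>T. \<forall>b\<in>B. \<exists>c. bracket t b = c *s b))"

definition k_rank :: "'v set \<Rightarrow> nat" where
  "k_rank S = Max {dim T | T. split_torus T S}"

definition isotropic :: "'v set \<Rightarrow> bool" where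
  "isotropic S \<longleftrightarrow> k_rank S \<ge> 1"

text \<open>\<open>isotropic_part s\<close> is the sum \<open>s\<^sub>n\<^sub>c\<close> of the isotropic simple factors of \<open>s\<close>.\<close>

definition isotropic_part :: "'v set \<Rightarrow> 'v set" where
  "isotropic_part s = span (\<Union>{S. ideal_of S s \<and> simple S \<and> isotropic S})"

text \<open>\<open>s\<close> is a Levi factor; by conjugacy of Levi factors the condition does not depend on it.\<close>

definition M_decomposed :: "'v set \<Rightarrow> bool" where
  "M_decomposed s \<longleftrightarrow> bracket_span (isotropic_part s) (radical UNIV) = {0}"

end


section \<open>Isomorphisms and semidirect products\<close>

text \<open>A Lie algebra carried by a subset of a type is given by its scalar multiplication, bracket and
  carrier.\<close>

definition lie_isomorphic ::
  "('k \<Rightarrow> 'v \<Rightarrow> 'v) \<Rightarrow> ('v \<Rightarrow> 'v \<Rightarrow> 'v) \<Rightarrow> 'v::ab_group_add set \<Rightarrow>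
   ('k \<Rightarrow> 'w \<Rightarrow> 'w) \<Rightarrow> ('w \<Rightarrow> 'w \<Rightarrow> 'w) \<Rightarrow> 'w::ab_group_add set \<Rightarrow> bool" where
  "lie_isomorphic smul\<^sub>1 bracket\<^sub>1 L\<^sub>1 smul\<^sub>2 bracket\<^sub>2 L\<^sub>2 \<longleftrightarrow>
     (\<exists>f. bij_betw f L\<^sub>1 L\<^sub>2 \<and>
       (\<forall>x\<in>L\<^sub>1. \<forall>y\<in>L\<^sub>1. f (x + y) = f x + f y) \<and>
       (\<forall>c. \<forall>x\<in>L\<^sub>1. f (smul\<^sub>1 c x) = smul\<^sub>2 c (f x)) \<and>
       (\<forall>x\<in>L\<^sub>1. \<forall>y\<in>L\<^sub>1. f (bracket\<^sub>1 x y) = bracket\<^sub>2 (f x) (f y)))"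

definition pair_scale :: "('k \<Rightarrow> 'v \<Rightarrow> 'v) \<Rightarrow> ('k \<Rightarrow> 'w \<Rightarrow> 'w) \<Rightarrow> 'k \<Rightarrow> 'v \<times> 'w \<Rightarrow> 'v \<times> 'w" where
  "pair_scale smul\<^sub>1 smul\<^sub>2 c = (\<lambda>(x, y). (smul\<^sub>1 c x, smul\<^sub>2 c y))"

definition semidirect_bracket ::
  "('v \<Rightarrow> 'v \<Rightarrow> 'v) \<Rightarrow> ('w \<Rightarrow> 'w \<Rightarrow> 'w) \<Rightarrow> ('v \<Rightarrow> 'w \<Rightarrow> 'w) \<Rightarrow>
   'v \<times> 'w \<Rightarrow> 'v \<times> 'w \<Rightarrow> 'v \<times> 'w::ab_group_add" where
  "semidirect_bracket bracket\<^sub>1 bracket\<^sub>2 act =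
     (\<lambda>(s, x) (t, y). (bracket\<^sub>1 s t, bracket\<^sub>2 x y + act s y - act t x))"


section \<open>The Lie algebra \<open>sl\<^sub>2\<close> and its irreducible modules\<close>

definition sl2 :: "('k::field ^ 2 ^ 2) set" where
  "sl2 = {A. trace A = 0}"

definition sl2_scale :: "'k::field \<Rightarrow> 'k ^ 2 ^ 2 \<Rightarrow> 'k ^ 2 ^ 2" where
  "sl2_scale c A = (\<chi> i j. c * A $ i $ j)"

definition sl2_bracket :: "'k::field ^ 2 ^ 2 \<Rightarrow> 'k ^ 2 ^ 2 \<Rightarrow> 'k ^ 2 ^ 2" where
  "sl2_bracket A B = A ** B - B ** A"

text \<open>\<open>coord_space n\<close> is \<open>K\<^sup>n\<close>, with vectors as functions on \<^typ>\<open>nat\<close> supported on \<open>{..<n}\<close>.\<close>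

definition coord_space :: "nat \<Rightarrow> (nat \<Rightarrow> 'k::field) set" where
  "coord_space n = {f. \<forall>i\<ge>n. f i = 0}"

definition coord_scale :: "'k::field \<Rightarrow> (nat \<Rightarrow> 'k) \<Rightarrow> nat \<Rightarrow> 'k" where
  "coord_scale c f = (\<lambda>i. c * f i)"

definition sl2_module :: "nat \<Rightarrow> ('k::field ^ 2 ^ 2 \<Rightarrow> (nat \<Rightarrow> 'k) \<Rightarrow> nat \<Rightarrow> 'k) \<Rightarrow> bool" where
  "sl2_module n act \<longleftrightarrow>
     (\<forall>A\<in>sl2. \<forall>v\<in>coord_space n. act A v \<in> coord_space n) \<and>
     (\<forall>A\<in>sl2. \<forall>v\<in>coord_space n. \<forall>w\<in>coord_space n. act A (v + w) = act A v + act A w) \<and>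
     (\<forall>A\<in>sl2. \<forall>c. \<forall>v\<in>coord_space n. act A (coord_scale c v) = coord_scale c (act A v)) \<and>
     (\<forall>A\<in>sl2. \<forall>B\<in>sl2. \<forall>v\<in>coord_space n. act (A + B) v = act A v + act B v) \<and>
     (\<forall>c. \<forall>A\<in>sl2. \<forall>v\<in>coord_space n. act (sl2_scale c A) v = coord_scale c (act A v)) \<and>
     (\<forall>A\<in>sl2. \<forall>B\<in>sl2. \<forall>v\<in>coord_space n.
        act (sl2_bracket A B) v = act A (act B v) - act B (act A v))"

text \<open>The \<open>n\<close>-dimensional irreducible module \<open>v\<^sub>n\<close> is unique only up to isomorphism: \<open>is_v n act\<close>
  says that \<open>act\<close> is one of its realizations on \<open>K\<^sup>n\<close>.\<close>

definition is_v :: "nat \<Rightarrow> ('k::field ^ 2 ^ 2 \<Rightarrow> (nat \<Rightarrow> 'k) \<Rightarrow> nat \<Rightarrow> 'k) \<Rightarrow> bool" where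
  "is_v n act \<longleftrightarrow> n \<ge> 1 \<and> sl2_module n act \<and>
     (\<forall>W. module.subspace coord_scale W \<and> W \<subseteq> coord_space n \<and> (\<forall>A\<in>sl2. \<forall>w\<in>W. act A w \<in> W)
        \<longrightarrow> W = {0} \<or> W = coord_space n)"

definition invariant_alternating_form ::
  "nat \<Rightarrow> ('k::field ^ 2 ^ 2 \<Rightarrow> (nat \<Rightarrow> 'k) \<Rightarrow> nat \<Rightarrow> 'k) \<Rightarrow>
   ((nat \<Rightarrow> 'k) \<Rightarrow> (nat \<Rightarrow> 'k) \<Rightarrow> 'k) \<Rightarrow> bool" where
  "invariant_alternating_form n act \<phi> \<longleftrightarrow>
     (\<forall>x\<in>coord_space n. \<forall>y\<in>coord_space n. \<forall>z\<in>coord_space n.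
        \<phi> (x + y) z = \<phi> x z + \<phi> y z \<and> \<phi> x (y + z) = \<phi> x y + \<phi> x z) \<and>
     (\<forall>c. \<forall>x\<in>coord_space n. \<forall>y\<in>coord_space n.
        \<phi> (coord_scale c x) y = c * \<phi> x y \<and> \<phi> x (coord_scale c y) = c * \<phi> x y) \<and>
     (\<forall>x\<in>coord_space n. \<phi> x x = 0) \<and>
     (\<forall>A\<in>sl2. \<forall>x\<in>coord_space n. \<forall>y\<in>coord_space n. \<phi> (act A x) y + \<phi> x (act A y) = 0)"

text \<open>\<open>L \<cong> sl\<^sub>2 \<ltimes> v\<^sub>n\<close>, with \<open>v\<^sub>n\<close> as an abelian Lie algebra.\<close>

definition iso_sl2_v ::
  "('k::field \<Rightarrow> 'v \<Rightarrow> 'v) \<Rightarrow> ('v \<Rightarrow> 'v \<Rightarrow> 'v) \<Rightarrow> 'v::ab_group_add set \<Rightarrow> nat \<Rightarrow> bool" where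
  "iso_sl2_v smul bracket L n \<longleftrightarrow>
     (\<exists>act. is_v n act \<and>
        lie_isomorphic smul bracket L
          (pair_scale sl2_scale coord_scale)
          (semidirect_bracket sl2_bracket (\<lambda>x y. 0) act)
          (sl2 \<times> coord_space n))"

text \<open>\<open>L \<cong> sl\<^sub>2 \<ltimes> h\<^sub>2\<^sub>m\<^sub>+\<^sub>1\<close>, where \<open>h\<^sub>2\<^sub>m\<^sub>+\<^sub>1 = v\<^sub>2\<^sub>m \<oplus> K\<close> is the Heisenberg Lie algebra.\<close>

definition iso_sl2_heisenberg ::
  "('k::field \<Rightarrow> 'v \<Rightarrow> 'v) \<Rightarrow> ('v \<Rightarrow> 'v \<Rightarrow> 'v) \<Rightarrow> 'v::ab_group_add set \<Rightarrow> nat \<Rightarrow> bool" where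
  "iso_sl2_heisenberg smul bracket L m \<longleftrightarrow>
     (\<exists>act \<phi>. is_v (2 * m) act \<and> invariant_alternating_form (2 * m) act \<phi> \<and>
        (\<exists>x\<in>coord_space (2 * m). \<exists>y\<in>coord_space (2 * m). \<phi> x y \<noteq> 0) \<and>
        lie_isomorphic smul bracket L
          (pair_scale sl2_scale (pair_scale coord_scale (*)))
          (semidirect_bracket sl2_bracket
            (\<lambda>(x, a) (y, b). (0, \<phi> x y))
            (\<lambda>A (x, a). (act A x, 0)))
          (sl2 \<times> (coord_space (2 * m) \<times> UNIV)))"

end

theory Submission
  imports Defs
begin

text \<open>
The algebra fails to be M-decomposed exactly when some isotropic simple factor \<open>S\<close> of the Levi factor
does not commute with some solvable ideal \<open>I\<close>. The proof finds a copy of \<open>sl\<^sub>2\<close> inside \<open>S\<close> that still acts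
nontrivially on \<open>I\<close>, and then shrinks \<open>I\<close> until only an irreducible module, or a Heisenberg algebra over
one, is left.

\<^bold>\<open>The copy of \<open>sl\<^sub>2\<close>.\<close> Isotropy gives \<open>h\<^sub>0 \<in> S\<close> whose adjoint action on \<open>S\<close> is diagonalizable over \<open>K\<close> and
not zero. An eigenvector \<open>e\<close> for a nonzero eigenvalue is ad-nilpotent, so the Jacobson--Morozov argument
(\<open>jacobson_morozov\<close>) completes it to a triple \<open>e, h, f\<close>, as soon as the trace form of \<open>S\<close> is
nondegenerate. As \<open>S\<close> is simple, it is enough that the trace form is not zero, and the diagonalizable
\<open>h\<^sub>0\<close> makes this elementary over any field of characteristic zero (\<open>trace_form_nonzero\<close>): a
\<open>\<rat>\<close>-linear functional \<open>\<phi>\<close> on \<open>K\<close> turns the eigenspace decomposition into a derivation \<open>D\<close> with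
\<open>tr (ad h\<^sub>0 \<circ> D) = \<Sum> c \<phi>(c)\<close>, whose image under \<open>\<phi>\<close> is a positive sum of squares, whereas a vanishing trace form
would force this trace to vanish because \<open>h\<^sub>0\<close> is a sum of brackets. The elements of \<open>S\<close> that centralize
\<open>I\<close> form an ideal of \<open>S\<close>, hence are zero; so \<open>e\<close> acts nontrivially on \<open>I\<close>.

\<^bold>\<open>The module.\<close> Among the \<open>sl\<^sub>2\<close>-stable subalgebras of \<open>I\<close> on which \<open>e\<close> acts nontrivially choose \<open>N\<close> of
least dimension (\<open>minimal_stable_subalgebra\<close>). Since \<open>N\<close> is solvable, the stable subalgebra \<open>[N, N]\<close> is strictly smaller, so
\<open>sl\<^sub>2\<close> acts trivially on \<open>[N, N]\<close>; by the Jacobi identity \<open>[sl\<^sub>2, N]\<close> then commutes with \<open>[N, N]\<close>. Take a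
highest weight vector \<open>v \<in> N\<close> of positive weight \<open>d\<close> (\<open>highest_weight_vector_exists\<close>) and the string
\<open>w\<^sub>i = (ad f)\<^sup>i v\<close>. The brackets \<open>[w\<^sub>i, w\<^sub>j]\<close> are invariant, so comparing weights and applying \<open>f\<close> gives
\<open>[w\<^sub>i, w\<^sub>j] = 0\<close> unless \<open>i + j = d\<close>, and \<open>[w\<^sub>i, w\<^sub>d\<^sub>-\<^sub>i] = (-1)\<^sup>i c\<^sub>0\<close> for a single element \<open>c\<^sub>0\<close> that commutes
with the triple and with the string (\<open>bracket_w_w\<close>). If \<open>c\<^sub>0 = 0\<close>, the triple and the string span \<open>sl\<^sub>2 \<ltimes> v\<^sub>d\<^sub>+\<^sub>1\<close>.
Otherwise antisymmetry makes \<open>d\<close> odd, and together with \<open>c\<^sub>0\<close> they span \<open>sl\<^sub>2 \<ltimes> h\<^sub>d\<^sub>+\<^sub>2\<close>. The triple meets \<open>I\<close>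
trivially because \<open>sl\<^sub>2\<close> is perfect and \<open>I\<close> is solvable, which makes these sums direct.
\<close>

(* In the locales below the symbol *s is the scalar multiplication of the ambient space. *)
no_notation vector_scalar_mult (infixl \<open>*s\<close> 70)

section \<open>Traces and nilpotent operators\<close>

locale char0_space = finite_dimensional_vector_space scale Basis
  for scale :: "'k::field_char_0 \<Rightarrow> 'v::ab_group_add \<Rightarrow> 'v" (infixr \<open>*s\<close> 75)
    and Basis :: "'v set"
begin

sublocale pair: finite_dimensional_vector_space_pair scale Basis scale Basis
  by unfold_locales

abbreviation endo :: "('v \<Rightarrow> 'v) \<Rightarrow> bool" where
  "endo \<equiv> Vector_Spaces.linear scale scale"

lemma endoI:
  "(\<And>x y. f (x + y) = f x + f y) \<Longrightarrow> (\<And>c x. f (c *s x) = c *s f x) \<Longrightarrow> endo f"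
  unfolding Vector_Spaces.linear_iff using vector_space_axioms by simp

lemmas endo_simps = pair.linear_0 pair.linear_add pair.linear_scale pair.linear_neg
  pair.linear_diff

lemma endo_comp: "endo f \<Longrightarrow> endo g \<Longrightarrow> endo (\<lambda>x. f (g x))"
  using Vector_Spaces.linear_compose[of scale scale g scale f] by (simp add: comp_def)

lemma endo_funpow: "endo f \<Longrightarrow> endo (f ^^ n)"
  by (induction n) (auto intro: linear_id Vector_Spaces.linear_compose)

lemma subspace_basis:
  assumes "subspace U"
  obtains B where "independent B" "span B = U" "finite B" "card B = dim U"
  by (metis assms basis_exists finiteI_independent span_subspace)

text \<open>The diagonal sum of \<open>f\<close> in the basis \<open>B\<close> of \<open>span B\<close>. It is the trace of the restriction of \<open>f\<close> only if
\<open>f\<close> maps \<open>span B\<close> into itself: \<^const>\<open>representation\<close> is constantly \<open>0\<close> on vectors outside \<open>span B\<close>.\<close>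

definition trace_on :: "'v set \<Rightarrow> ('v \<Rightarrow> 'v) \<Rightarrow> 'k" where
  "trace_on B f = (\<Sum>b\<in>B. representation B (f b) b)"

lemma trace_on_add:
  assumes "independent B" "\<And>b. b \<in> B \<Longrightarrow> f b \<in> span B" "\<And>b. b \<in> B \<Longrightarrow> g b \<in> span B"
  shows "trace_on B (\<lambda>x. f x + g x) = trace_on B f + trace_on B g"
  unfolding trace_on_def using assms by (simp add: representation_add sum.distrib)

lemma trace_on_scale:
  assumes "independent B" "\<And>b. b \<in> B \<Longrightarrow> f b \<in> span B"
  shows "trace_on B (\<lambda>x. c *s f x) = c * trace_on B f"
  unfolding trace_on_def using assms by (simp add: representation_scale sum_distrib_left)

lemma trace_on_diff:
  assumes "independent B" "\<And>b. b \<in> B \<Longrightarrow> f b \<in> span B" "\<And>b. b \<in> B \<Longrightarrow> g b \<in> span B"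
  shows "trace_on B (\<lambda>x. f x - g x) = trace_on B f - trace_on B g"
  unfolding trace_on_def using assms by (simp add: representation_diff sum_subtractf)

lemma trace_on_cong: "(\<And>b. b \<in> B \<Longrightarrow> f b = g b) \<Longrightarrow> trace_on B f = trace_on B g"
  unfolding trace_on_def by simp

lemma representation_image:
  assumes B: "independent B" and C: "independent C" and f: "endo f"
    and fC: "\<And>x. x \<in> C \<Longrightarrow> f x \<in> span B" and x: "x \<in> span C"
  shows "representation B (f x) b = (\<Sum>c\<in>C. representation C x c * representation B (f c) b)"
proof -
  have fin: "finite C" using C by (rule finiteI_independent)
  have "f x = f (\<Sum>c\<in>C. representation C x c *s c)"
    using sum_representation_eq[OF C x fin order_refl] by simp
  also have "\<dots> = (\<Sum>c\<in>C. representation C x c *s f c)"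
    by (simp add: pair.linear_sum[OF f] pair.linear_scale[OF f])
  finally have "representation B (f x) b = representation B (\<Sum>c\<in>C. representation C x c *s f c) b"
    by simp
  also have "\<dots> = (\<Sum>c\<in>C. representation B (representation C x c *s f c) b)"
    by (subst representation_sum[OF B]) (auto intro: span_scale fC)
  also have "\<dots> = (\<Sum>c\<in>C. representation C x c * representation B (f c) b)"
    by (simp add: representation_scale[OF B] fC)
  finally show ?thesis .
qed

text \<open>Two bases are allowed because this one identity then gives both the cyclicity of the trace and, with
\<open>g\<close> the identity, its independence of the basis. Both sides expand to the same double sum.\<close>

lemma trace_on_commute:
  assumes B: "independent B" and C: "independent C" and f: "endo f"  and g: "endo g"
    and fC: "\<And>x. x \<in> span C \<Longrightarrow> f x \<in> span B" and gB: "\<And>x. x \<in> span B \<Longrightarrow> g x \<in> span C"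
  shows "trace_on B (\<lambda>x. f (g x)) = trace_on C (\<lambda>x. g (f x))"
proof -
  have "trace_on B (\<lambda>x. f (g x))
      = (\<Sum>b\<in>B. \<Sum>c\<in>C. representation C (g b) c * representation B (f c) b)"
    unfolding trace_on_def
    by (rule sum.cong[OF refl], rule representation_image[OF B C f])
       (auto intro: fC gB span_base)
  also have "\<dots> = (\<Sum>c\<in>C. \<Sum>b\<in>B. representation B (f c) b * representation C (g b) c)"
    by (subst sum.swap) (simp add: mult.commute)
  also have "\<dots> = trace_on C (\<lambda>x. g (f x))"
    unfolding trace_on_def
    by (rule sum.cong[OF refl], rule representation_image[OF C B g, symmetric])
       (auto intro: fC gB span_base)
  finally show ?thesis .
qed

lemma trace_on_basis_indep:
  assumes "independent B" "independent C" "span B = span C" "endo f"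
    "\<And>x. x \<in> span B \<Longrightarrow> f x \<in> span B"
  shows "trace_on B f = trace_on C f"
  using trace_on_commute[of B C f "\<lambda>x. x"] assms linear_ident by simp

text \<open>Induction on the nilpotency index: in a basis adapted to \<open>f U \<subseteq> U\<close> the diagonal entries outside \<open>f U\<close>
vanish, so the trace on \<open>U\<close> is the trace on \<open>f U\<close>, where the index is smaller.\<close>

lemma trace_on_nilpotent:
  assumes "independent B" "endo f" "\<And>x. x \<in> span B \<Longrightarrow> f x \<in> span B"
    "\<And>x. x \<in> span B \<Longrightarrow> (f ^^ n) x = 0"
  shows "trace_on B f = 0"
  using assms
proof (induction n arbitrary: B)
  case 0
  then have "B \<subseteq> {0}" by (auto intro: span_base)
  with \<open>independent B\<close> have "B = {}" using dependent_zero by blast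
  then show ?case by (simp add: trace_on_def)
next
  case (Suc n)
  define W where "W = f ` span B"
  have W: "subspace W" unfolding W_def
    using pair.linear_subspace_image[OF Suc.prems(2) subspace_span] .
  have WB: "W \<subseteq> span B" using Suc.prems(3) by (auto simp: W_def)
  obtain C where C: "independent C" "span C = W" "finite C"
    using subspace_basis[OF W] by metis
  have CB: "C \<subseteq> span B" using WB C(2) span_base by blast
  obtain D where D: "C \<subseteq> D" "D \<subseteq> span B" "independent D" "span B \<subseteq> span D"
    using maximal_independent_subset_extend[OF CB C(1)] by metis
  have sp: "span D = span B" using D(2,4) by (metis span_minimal subspace_span subset_antisym)
  have finD: "finite D" by (rule finiteI_independent[OF D(3)])
  have rep: "representation D (f x) = representation C (f x)" if "x \<in> span B" for x
    by (rule representation_extend[OF D(3) _ D(1)]) (use that C W_def in auto)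
  have "trace_on B f = trace_on D f"
    by (rule trace_on_basis_indep) (use Suc.prems D(3) sp in auto)
  also have "\<dots> = (\<Sum>b\<in>D. representation C (f b) b)"
    unfolding trace_on_def using rep D(2) by (intro sum.cong) auto
  also have "\<dots> = (\<Sum>b\<in>C. representation C (f b) b)"
    by (rule sum.mono_neutral_right[OF finD D(1)]) (auto dest: representation_ne_zero)
  also have "\<dots> = trace_on C f" by (simp add: trace_on_def)
  also have "\<dots> = 0"
  proof (rule Suc.IH[OF C(1) Suc.prems(2)])
    show "f x \<in> span C" if "x \<in> span C" for x
      using that C(2) WB by (auto simp: W_def)
    show "(f ^^ n) x = 0" if x: "x \<in> span C" for x
    proof -
      obtain y where "y \<in> span B" "x = f y" using x unfolding C(2) W_def by blast
      then show ?thesis using Suc.prems(4)[of y] by (simp add: funpow_swap1)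
    qed
  qed
  finally show ?case .
qed

text \<open>On the stable image \<open>U\<close> of the powers of \<open>A\<close> the operator \<open>A\<close> is invertible, and the hypothesis says that
conjugation by \<open>A\<close> carries \<open>H\<close> to \<open>H + a\<close> there. Equality of traces gives \<open>a \<cdot> dim U = 0\<close>, so \<open>U = 0\<close>. Traces take
the place of eigenvalues of \<open>H\<close>, which need not exist in the ground field.\<close>

lemma weight_shift_nilpotent:
  assumes A: "endo A" and H: "endo H" and shift: "\<And>x. H (A x) = A (H x) + a *s A x" and a: "a \<noteq> 0"
  shows "\<exists>n. \<forall>x. (A ^^ n) x = 0"
proof -
  \<comment> \<open>The images decrease, so one of least dimension is stable under further powers.\<close>
  have "\<exists>n. \<forall>m. dim (range (A ^^ n)) \<le> dim (range (A ^^ m))"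
    using ex_has_least_nat[of "\<lambda>_. True" _ "\<lambda>n. dim (range (A ^^ n))"] by auto
  then obtain n where n: "\<And>m. dim (range (A ^^ n)) \<le> dim (range (A ^^ m))" by blast
  define U where "U = range (A ^^ n)"
  have U: "subspace U"
    unfolding U_def using pair.linear_subspace_image[OF endo_funpow[OF A] subspace_UNIV] .
  have AU_sub: "A ` U \<subseteq> U" unfolding U_def by (auto simp: funpow_swap1)
  have AU: "A ` U = U"
  proof -
    have "A ` U = range (A ^^ Suc n)" unfolding U_def by (auto simp: image_comp)
    moreover have "dim U \<le> dim (range (A ^^ Suc n))" unfolding U_def by (rule n)
    ultimately show ?thesis
      using AU_sub pair.linear_subspace_image[OF A U] U subspace_dim_equal by metis
  qed
  have Hpow: "H ((A ^^ k) x) = (A ^^ k) (H x) + (of_nat k * a) *s (A ^^ k) x" for k x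
  proof (induction k arbitrary: x)
    case (Suc k)
    show ?case
      by (simp add: shift Suc endo_simps[OF A] scale_left_distrib algebra_simps)
  qed simp
  have HU: "H x \<in> U" if x: "x \<in> U" for x
  proof -
    obtain y where "x = (A ^^ n) y" using x unfolding U_def by blast
    then have "H x = (A ^^ n) (H y) + (of_nat n * a) *s (A ^^ n) y" by (simp add: Hpow)
    then show ?thesis using U unfolding U_def by (metis rangeI subspace_add subspace_scale)
  qed
  obtain B where B: "independent B" "span B = U" "finite B" "card B = dim U"
    using subspace_basis[OF U] by metis
  have "dim U \<le> card (A ` B)"
    by (rule dim_le_card) (use B pair.linear_span_image[OF A, of B] AU in auto)
  then have card: "card (A ` B) = card B" using B(3,4) card_image_le[of B A] by simp
  have indep: "independent (A ` B)"
    by (rule card_le_dim_spanning[of _ U])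
       (use card B AU pair.linear_span_image[OF A, of B] span_superset[of B] in auto)
  have injU: "inj_on A U"
    using pair.linear_inj_on_span_independent_image[OF A indep]
      eq_card_imp_inj_on[OF B(3) card] B(2) by simp
  obtain G where G: "range G \<subseteq> U" "endo G" "\<And>v. v \<in> U \<Longrightarrow> G (A v) = v"
    using pair.linear_exists_left_inverse_on[OF A U injU] by blast
  have AG: "A (G v) = v" if "v \<in> U" for v
    using that AU G(3) by (metis imageE)
  have "trace_on B H = trace_on B (\<lambda>x. (\<lambda>y. H (A y)) (G x))"
    by (rule trace_on_cong) (use AG B(2) span_base in auto)
  also have "\<dots> = trace_on B (\<lambda>x. G (H (A x)))"
    by (rule trace_on_commute[OF B(1) B(1)])
       (use A H G HU AU_sub B(2) in \<open>auto intro: endo_comp\<close>)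
  also have "\<dots> = trace_on B (\<lambda>x. H x + a *s x)"
  proof (rule trace_on_cong)
    fix b assume "b \<in> B"
    then have b: "b \<in> U" using B(2) span_base by blast
    have "G (H (A b)) = G (A (H b + a *s b))" by (simp add: shift endo_simps[OF A])
    also have "\<dots> = H b + a *s b"
      by (rule G(3)) (use b HU U in \<open>auto intro: subspace_add subspace_scale\<close>)
    finally show "G (H (A b)) = H b + a *s b" .
  qed
  also have "\<dots> = trace_on B H + a * trace_on B (\<lambda>x. x)"
    using trace_on_add[OF B(1), of H "\<lambda>x. a *s x"] trace_on_scale[OF B(1), of "\<lambda>x. x" a]
      HU U B(2) span_base by (auto simp: subspace_scale)
  finally have "trace_on B (\<lambda>x. x) = 0" using a by simp
  moreover have "trace_on B (\<lambda>x. x) = of_nat (card B)"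
    unfolding trace_on_def using B(1) by (simp add: representation_basis)
  ultimately have "U = {0}" using B by (metis card_0_eq of_nat_eq_0_iff span_empty)
  then show ?thesis unfolding U_def by blast
qed

end

context char0_space begin

text \<open>A nondegenerate form on a finite-dimensional space represents every linear functional, in particular
one that kills \<open>W\<close> but not \<open>e\<close>. In a basis \<open>D\<close> through \<open>W\<close> and \<open>e\<close>, the map \<open>x \<mapsto> \<Sum>b\<in>D. \<beta> x b *s b\<close> is injective,
hence surjective, and a preimage of \<open>e\<close> is the required vector.\<close>

lemma nondegenerate_separates:
  assumes add: "\<And>x y z. x \<in> U \<Longrightarrow> y \<in> U \<Longrightarrow> z \<in> U \<Longrightarrow> \<beta> (x + y) z = \<beta> x z + \<beta> y z"
      "\<And>x y z. x \<in> U \<Longrightarrow> y \<in> U \<Longrightarrow> z \<in> U \<Longrightarrow> \<beta> x (y + z) = \<beta> x y + \<beta> x z"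
    and scale: "\<And>c x y. x \<in> U \<Longrightarrow> y \<in> U \<Longrightarrow> \<beta> (c *s x) y = c * \<beta> x y"
      "\<And>c x y. x \<in> U \<Longrightarrow> y \<in> U \<Longrightarrow> \<beta> x (c *s y) = c * \<beta> x y"
    and nondeg: "\<And>x. x \<in> U \<Longrightarrow> \<forall>y\<in>U. \<beta> x y = 0 \<Longrightarrow> x = 0"
    and U: "subspace U" and W: "subspace W" "W \<subseteq> U" and e: "e \<in> U" "e \<notin> W"
  obtains z where "z \<in> U" "\<beta> z e \<noteq> 0" "\<And>w. w \<in> W \<Longrightarrow> \<beta> z w = 0"
proof -
  obtain C where C: "independent C" "span C = W" "finite C"
    using subspace_basis[OF W(1)] by metis
  have CU: "insert e C \<subseteq> U" using e(1) W(2) C(2) span_base by blast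
  have "independent (insert e C)" using C(1,2) e(2) independent_insertI by simp
  then obtain D where D: "insert e C \<subseteq> D" "D \<subseteq> U" "independent D" "U \<subseteq> span D"
    using maximal_independent_subset_extend[OF CU] by metis
  have spD: "span D = U" using D(2,4) U by (metis span_subspace)
  have finD: "finite D" by (rule finiteI_independent[OF D(3)])
  define T where "T = pair.construct D (\<lambda>d. \<Sum>b\<in>D. \<beta> d b *s b)"
  have endoT: "endo T" unfolding T_def by (rule pair.linear_construct[OF D(3)])
  have zero: "\<beta> 0 b = 0" "\<beta> b 0 = 0" if "b \<in> U" for b
    using scale(1)[of b b 0] scale(2)[of b b 0] that by auto
  have T: "T x = (\<Sum>b\<in>D. \<beta> x b *s b)" if "x \<in> U" for x
  proof -
    have "x \<in> span D" using that spD by simp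
    then have "x \<in> U \<and> T x = (\<Sum>b\<in>D. \<beta> x b *s b)"
    proof (induction rule: span_induct_alt)
      case base
      then show ?case using zero D(2) U by (auto simp: subspace_0 endo_simps[OF endoT] intro!: sum.neutral)
    next
      case (step c x y)
      have xU: "x \<in> U" and yU: "y \<in> U" using step spD D(2) by auto
      have Tx: "T x = (\<Sum>b\<in>D. \<beta> x b *s b)"
        unfolding T_def using pair.construct_basis[OF D(3) step(1)] .
      have "\<beta> (c *s x + y) b = c * \<beta> x b + \<beta> y b" if "b \<in> D" for b
        using add(1)[of "c *s x" y b] scale(1)[of x b c] xU yU D(2) that U
        by (auto simp: subspace_scale)
      then show ?case
        using step.IH xU yU U
        by (simp add: endo_simps[OF endoT] Tx scale_left_distrib sum.distrib scale_sum_right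
              subspace_add subspace_scale cong: sum.cong)
    qed
    then show ?thesis by blast
  qed
  have TU: "T ` U \<subseteq> U" using T D(2) U by (auto intro!: subspace_sum subspace_scale)
  have inj: "inj_on T U"
  proof (rule inj_onI)
    fix x y assume xy: "x \<in> U" "y \<in> U" "T x = T y"
    have d: "x - y \<in> U" using xy U by (simp add: subspace_diff)
    have "(\<Sum>b\<in>D. \<beta> (x - y) b *s b) = 0" using T[OF d] xy(3) by (simp add: endo_simps[OF endoT])
    then have D0: "\<beta> (x - y) b = 0" if "b \<in> D" for b
      using independentD[OF D(3) finD order_refl] that by blast
    have "v \<in> U \<and> \<beta> (x - y) v = 0" if "v \<in> U" for v
      using that unfolding spD[symmetric]
    proof (induction rule: span_induct_alt)
      case (step c u v)
      have u: "u \<in> U" "c *s u \<in> U" and v: "v \<in> U" "\<beta> (x - y) v = 0"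
        using step D(2) U spD by (auto simp: subspace_scale)
      have "\<beta> (x - y) (c *s u + v) = 0"
        using add(2)[OF d u(2) v(1)] scale(2)[OF d u(1), of c] v(2) D0[OF step(1)] by simp
      then show ?case using u(2) v(1) U spD by (simp add: subspace_add)
    qed (use zero d U in \<open>auto simp: subspace_0\<close>)
    then have "\<forall>v\<in>U. \<beta> (x - y) v = 0" by blast
    from nondeg[OF d this] show "x = y" by simp
  qed
  have spU: "span U = U" using U by simp
  have "dim (T ` U) = dim U"
    by (rule pair.dim_image_eq[OF endoT]) (unfold spU, rule inj)
  then have "T ` U = U"
    using subspace_dim_equal[OF pair.linear_subspace_image[OF endoT U] U TU] by simp
  then obtain z where z: "z \<in> U" "T z = e" using e(1) by (metis imageE)
  have "(\<Sum>b\<in>D. (if b = e then 1 else 0) *s b) = (\<Sum>b\<in>D. if b = e then b else 0)"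
    by (intro sum.cong) auto
  also have "\<dots> = e" using D(1) finD by simp
  finally have "(\<Sum>b\<in>D. (\<beta> z b - (if b = e then 1 else 0)) *s b) = 0"
    using T[OF z(1)] z(2) by (simp only: scale_left_diff_distrib sum_subtractf diff_self)
  then have \<beta>: "\<beta> z b = (if b = e then 1 else 0)" if "b \<in> D" for b
    using independentD[OF D(3) finD order_refl _ that] by fastforce
  have eC: "e \<notin> C" using e(2) C(2) span_base by blast
  have "w \<in> U \<and> \<beta> z w = 0" if "w \<in> W" for w
    using that unfolding C(2)[symmetric]
  proof (induction rule: span_induct_alt)
    case (step c u v)
    have u: "u \<in> U" "c *s u \<in> U" "\<beta> z u = 0"
      using \<beta>[of u] D(1,2) eC step(1) U by (auto simp: subspace_scale)
    have v: "v \<in> U" "\<beta> z v = 0" using step(2) by auto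
    have "\<beta> z (c *s u + v) = 0"
      using add(2)[OF z(1) u(2) v(1)] scale(2)[OF z(1) u(1), of c] u(3) v(2) by simp
    then show ?case using u(2) v(1) U by (simp add: subspace_add)
  qed (use zero(2)[OF z(1)] U in \<open>simp add: subspace_0\<close>)
  then have "\<beta> z w = 0" if "w \<in> W" for w using that by blast
  moreover have "\<beta> z e \<noteq> 0" using \<beta>[of e] D(1) by simp
  ultimately show ?thesis using that z(1) by blast
qed

text \<open>With \<open>C = [A, B]\<close> commuting with \<open>A\<close>, the kernels of the powers of \<open>A\<close> are stable under \<open>AB\<close>. On
\<open>ker A\<^sup>k\<^sup>+\<^sup>1 / ker A\<^sup>k\<close>, which \<open>A\<^sup>k\<close> embeds into \<open>ker A\<close>, the operator \<open>AB\<close> acts as \<open>(k + 1) C\<close>, and \<open>C\<close> is nilpotent on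
\<open>ker A\<close> since \<open>A\<^sup>j B\<^sup>j = j! C\<^sup>j\<close> there. So each \<open>N\<close> applications of \<open>AB\<close> descend one step of the filtration.\<close>

lemma nilpotent_product:
  assumes A: "endo A" and B: "endo B" and C: "endo C"
    and AB: "\<And>x. A (B x) = B (A x) + C x" and AC: "\<And>x. A (C x) = C (A x)"
    and nil: "\<And>x. (A ^^ N) x = 0"
  shows "((\<lambda>x. A (B x)) ^^ (N * N)) x = 0"
proof -
  note Alin = endo_simps[OF A] and Blin = endo_simps[OF B] and Clin = endo_simps[OF C]
  \<comment> \<open>The Leibniz rule for the powers of \<open>A\<close>, as \<open>C\<close> commutes with them.\<close>
  have ApB: "(A ^^ Suc k) (B x) = B ((A ^^ Suc k) x) + of_nat (Suc k) *s C ((A ^^ k) x)" for k x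
  proof (induction k)
    case (Suc k)
    have "(A ^^ Suc (Suc k)) (B x) = A ((A ^^ Suc k) (B x))" by simp
    also have "\<dots> = A (B ((A ^^ Suc k) x)) + of_nat (Suc k) *s A (C ((A ^^ k) x))"
      unfolding Suc by (simp only: Alin)
    also have "\<dots> = B ((A ^^ Suc (Suc k)) x) + C ((A ^^ Suc k) x) + of_nat (Suc k) *s C ((A ^^ Suc k) x)"
      by (simp add: AB AC)
    also have "\<dots> = B ((A ^^ Suc (Suc k)) x) + of_nat (Suc (Suc k)) *s C ((A ^^ Suc k) x)"
      by (simp only: of_nat_Suc[of "Suc k"] scale_left_distrib scale_one add.assoc)
    finally show ?case .
  qed (simp add: AB)
  have ApB0: "(A ^^ Suc k) (B x) = of_nat (Suc k) *s C ((A ^^ k) x)" if "(A ^^ Suc k) x = 0" for k x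
    unfolding ApB that by (simp add: Blin)
  have step: "(A ^^ Suc (Suc k)) (B x) = 0" if "(A ^^ Suc k) x = 0" for k x
    using ApB0[OF that] that by (simp add: Alin AC Clin)
  have kerA: "(A ^^ Suc j) ((B ^^ j) x) = 0 \<and> (A ^^ j) ((B ^^ j) x) = fact j *s (C ^^ j) x"
    if "A x = 0" for x j
  proof (induction j)
    case (Suc j)
    have "(A ^^ Suc j) ((B ^^ Suc j) x) = (A ^^ Suc j) (B ((B ^^ j) x))" by simp
    also have "\<dots> = of_nat (Suc j) *s C ((A ^^ j) ((B ^^ j) x))"
      by (rule ApB0) (use Suc in blast)
    finally have "(A ^^ Suc j) ((B ^^ Suc j) x) = of_nat (Suc j) *s C ((A ^^ j) ((B ^^ j) x))" .
    moreover have "(A ^^ Suc (Suc j)) ((B ^^ Suc j) x) = 0"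
      using step[OF conjunct1[OF Suc]] by simp
    moreover have "of_nat (Suc j) *s C ((A ^^ j) ((B ^^ j) x)) = fact (Suc j) *s (C ^^ Suc j) x"
      using Suc by (simp add: Clin)
    ultimately show ?case by simp
  qed (use that in simp)
  have CN: "(C ^^ N) x = 0" if "A x = 0" for x
    using kerA[OF that, of N] nil by (metis fact_nonzero scale_eq_0_iff)
  let ?P = "\<lambda>x. A (B x)"
  have Plevel: "(A ^^ Suc k) ((?P ^^ j) x) = 0 \<and> (A ^^ k) ((?P ^^ j) x) = of_nat (Suc k) ^ j *s (C ^^ j) ((A ^^ k) x)"
    if "(A ^^ Suc k) x = 0" for k j x
  proof (induction j)
    case (Suc j)
    have "(A ^^ k) (?P ((?P ^^ j) x)) = (A ^^ Suc k) (B ((?P ^^ j) x))"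
      by (simp add: funpow_swap1)
    also have "\<dots> = of_nat (Suc k) *s C ((A ^^ k) ((?P ^^ j) x))"
      by (rule ApB0) (use Suc in blast)
    also have "\<dots> = of_nat (Suc k) ^ Suc j *s (C ^^ Suc j) ((A ^^ k) x)"
      using Suc by (simp add: Clin)
    finally have 1: "(A ^^ k) (?P ((?P ^^ j) x)) = of_nat (Suc k) ^ Suc j *s (C ^^ Suc j) ((A ^^ k) x)" .
    have "(A ^^ Suc k) (?P ((?P ^^ j) x)) = (A ^^ Suc (Suc k)) (B ((?P ^^ j) x))"
      by (simp add: funpow_swap1)
    then show ?case using 1 step[OF conjunct1[OF Suc]] by simp
  qed (use that in simp)
  \<comment> \<open>One step down in the filtration by the kernels of the powers of \<open>A\<close>.\<close>
  have drop: "(A ^^ k) ((?P ^^ N) x) = 0" if "(A ^^ Suc k) x = 0" for k x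
  proof -
    have "(C ^^ N) ((A ^^ k) x) = 0" by (rule CN) (use that in simp)
    then show ?thesis using Plevel[OF that, of N] by simp
  qed
  have "(?P ^^ (k * N)) x = 0" if "(A ^^ k) x = 0" for k x
    using that
  proof (induction k arbitrary: x)
    case (Suc k)
    have "(?P ^^ (k * N)) ((?P ^^ N) x) = 0" by (rule Suc.IH[OF drop[OF Suc.prems]])
    then show ?case by (simp add: funpow_add add.commute[of N])
  qed simp
  then show ?thesis using nil by blast
qed

end

section \<open>Brackets and the trace form\<close>

locale char0_lie_algebra = char0_space smul Basis + lie_algebra smul bracket
  for smul :: "'k::field_char_0 \<Rightarrow> 'v::ab_group_add \<Rightarrow> 'v" (infixr \<open>*s\<close> 75)
    and Basis :: "'v set" and bracket :: "'v \<Rightarrow> 'v \<Rightarrow> 'v"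
begin

lemma endo_bracket: "endo (bracket x)"
  by (rule endoI) (simp_all add: bracket_add_right bracket_scale_right)

lemma endo_bracket_left: "endo (\<lambda>x. bracket x y)"
  by (rule endoI) (simp_all add: bracket_add_left bracket_scale_left)

lemmas bracket_simps = endo_simps[OF endo_bracket]

lemma bracket_commute: "bracket y x = - bracket x y"
proof -
  have "bracket (x + y) (x + y) = bracket x y + bracket y x"
    unfolding bracket_add_left[of x y "x + y"] by (simp add: bracket_add_right bracket_self)
  then have "bracket y x + bracket x y = 0" by (simp only: bracket_self add.commute[of "bracket y x"])
  then show ?thesis by (simp only: eq_neg_iff_add_eq_0)
qed

lemma bracket_left_simps:
  "bracket 0 x = 0" "bracket (- y) x = - bracket y x" "bracket (y - z) x = bracket y x - bracket z x"
  by (simp_all add: endo_simps[OF endo_bracket_left])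

lemma bracket_derivation:
  "bracket x (bracket y z) = bracket (bracket x y) z + bracket y (bracket x z)"
proof -
  have "bracket z (bracket x y) = - bracket (bracket x y) z"
    "bracket y (bracket z x) = - bracket y (bracket x z)"
    using bracket_commute[of z "bracket x y"] bracket_commute[of z x] by (simp_all add: bracket_simps)
  then show ?thesis using jacobi[of x y z] by (simp add: algebra_simps)
qed

lemma subalgebra_mem: "subalgebra S \<Longrightarrow> x \<in> S \<Longrightarrow> y \<in> S \<Longrightarrow> bracket x y \<in> S"
  unfolding subalgebra_def by blast

text \<open>For a basis \<open>B\<close> of a subalgebra this is its Killing form.\<close>

definition trace_form :: "'v set \<Rightarrow> 'v \<Rightarrow> 'v \<Rightarrow> 'k" where
  "trace_form B x y = trace_on B (\<lambda>v. bracket x (bracket y v))"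

context
  fixes S B assumes S: "subalgebra S" and B: "independent B" "span B = S"
begin

lemma basis_mem: "b \<in> B \<Longrightarrow> b \<in> S" using B(2) span_base by blast

lemma trace_form_bilinear:
  "x \<in> S \<Longrightarrow> y \<in> S \<Longrightarrow> z \<in> S \<Longrightarrow> trace_form B (x + y) z = trace_form B x z + trace_form B y z"
  "x \<in> S \<Longrightarrow> y \<in> S \<Longrightarrow> z \<in> S \<Longrightarrow> trace_form B x (y + z) = trace_form B x y + trace_form B x z"
  "x \<in> S \<Longrightarrow> y \<in> S \<Longrightarrow> trace_form B (c *s x) y = c * trace_form B x y"
  "x \<in> S \<Longrightarrow> y \<in> S \<Longrightarrow> trace_form B x (c *s y) = c * trace_form B x y"
  unfolding trace_form_def
  using S B basis_mem
  by (simp_all add: bracket_add_left bracket_add_right bracket_scale_left bracket_scale_right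
       trace_on_add trace_on_scale subalgebra_mem)

lemma trace_form_sym:
  assumes "x \<in> S" "y \<in> S"
  shows "trace_form B x y = trace_form B y x"
  unfolding trace_form_def
  by (rule trace_on_commute) (use assms B S in \<open>auto intro: endo_bracket subalgebra_mem\<close>)

lemma trace_form_invariant:
  assumes x: "x \<in> S" and y: "y \<in> S" and z: "z \<in> S"
  shows "trace_form B (bracket x y) z = trace_form B x (bracket y z)"
proof -
  let ?t = "trace_on B"
  have e1: "trace_form B (bracket x y) z
      = ?t (\<lambda>v. bracket x (bracket y (bracket z v))) - ?t (\<lambda>v. bracket y (bracket x (bracket z v)))"
    unfolding trace_form_def
    by (subst trace_on_diff[OF B(1), symmetric])
       (use assms S B basis_mem in \<open>auto simp: subalgebra_mem bracket_derivation[of x y] intro!: trace_on_cong span_add\<close>)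
  have e2: "trace_form B x (bracket y z)
      = ?t (\<lambda>v. bracket x (bracket y (bracket z v))) - ?t (\<lambda>v. bracket x (bracket z (bracket y v)))"
    unfolding trace_form_def
    by (subst trace_on_diff[OF B(1), symmetric])
       (use assms S B basis_mem in \<open>auto simp: subalgebra_mem bracket_derivation[of y z] bracket_simps intro!: trace_on_cong span_add\<close>)
  have "?t (\<lambda>v. bracket y (bracket x (bracket z v))) = ?t (\<lambda>v. bracket x (bracket z (bracket y v)))"
    by (rule trace_on_commute[OF B(1) B(1), of "bracket y" "\<lambda>v. bracket x (bracket z v)"])
       (use assms B S in \<open>auto intro: endo_bracket endo_comp subalgebra_mem\<close>)
  with e1 e2 show ?thesis by simp
qed

end

end

section \<open>The trace form of a simple algebra and sl2 triples\<close>

text \<open>Coordinate along \<open>a\<close> in a basis of the field over its prime field.\<close>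

lemma rational_functional:
  fixes a :: "'k::field_char_0"
  assumes "a \<noteq> 0"
  obtains \<phi> :: "'k \<Rightarrow> rat" where "\<And>x y. \<phi> (x + y) = \<phi> x + \<phi> y"
    "\<And>q x. \<phi> (of_rat q * x) = q * \<phi> x" "\<phi> a = 1"
proof -
  interpret Q: vector_space "\<lambda>q (x::'k). of_rat q * x"
    by unfold_locales (simp_all add: algebra_simps of_rat_add of_rat_mult)
  have ind: "Q.independent {a}" using assms by simp
  let ?E = "Q.extend_basis {a}"
  have E: "Q.independent ?E" "Q.span ?E = UNIV" "a \<in> ?E"
    using Q.independent_extend_basis[OF ind] Q.span_extend_basis[OF ind] Q.extend_basis_superset[OF ind]
    by auto
  show ?thesis
    by (rule that[of "\<lambda>x. Q.representation ?E x a"])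
       (use E in \<open>simp_all add: Q.representation_add Q.representation_scale Q.representation_basis\<close>)
qed

context char0_space begin

lemma endo_add: "endo f \<Longrightarrow> endo g \<Longrightarrow> endo (\<lambda>x. f x + g x)"
  by (rule pair.linear_compose_add)

text \<open>Only two of the three \<open>sl\<^sub>2\<close> relations enter, so that the formula is available before a triple has
been completed, and with the roles of raising and lowering operators exchanged.\<close>

lemma sl2_power_commute:
  assumes A: "endo A" and AZ: "\<And>x. A (Z x) = Z (A x) + H x" and HA: "\<And>x. H (A x) = A (H x) + 2 *s A x"
  shows "(A ^^ Suc k) (Z x)
    = Z ((A ^^ Suc k) x) + of_nat (Suc k) *s (H ((A ^^ k) x) - of_nat k *s (A ^^ k) x)"
proof (induction k)
  case (Suc k)
  let ?y = "(A ^^ Suc k) x"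
  have AH: "A (H y) = H (A y) - 2 *s A y" for y using HA[of y] by simp
  have "(A ^^ Suc (Suc k)) (Z x) = A ((A ^^ Suc k) (Z x))" by simp
  also have "\<dots> = A (Z ?y) + of_nat (Suc k) *s (A (H ((A ^^ k) x)) - of_nat k *s ?y)"
    unfolding Suc by (simp add: endo_simps[OF A] del: of_nat_Suc)
  also have "\<dots> = Z (A ?y) + (H ?y + of_nat (Suc k) *s (H ?y - 2 *s ?y - of_nat k *s ?y))"
    by (simp add: AH AZ del: of_nat_Suc)
  also have "H ?y + of_nat (Suc k) *s (H ?y - 2 *s ?y - of_nat k *s ?y)
      = of_nat (Suc (Suc k)) *s (H ?y - of_nat (Suc k) *s ?y)"
  proof -
    have "H ?y + of_nat (Suc k) *s (H ?y - 2 *s ?y - of_nat k *s ?y)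
        = (1 + of_nat (Suc k)) *s H ?y - (of_nat (Suc k) * (2 + of_nat k)) *s ?y"
      by (simp only: scale_left_distrib scale_right_diff_distrib scale_right_distrib scale_scale
          scale_one ring_distribs diff_diff_eq add.assoc add_diff_eq)
    also have "of_nat (Suc k) * (2 + of_nat k) = (of_nat (Suc (Suc k)) * of_nat (Suc k) :: 'k)"
      by (simp add: algebra_simps)
    finally show ?thesis
      by (simp only: scale_right_diff_distrib scale_scale of_nat_Suc[of "Suc k"])
  qed
  finally show ?case by simp
qed (simp add: AZ)

end

context lie_algebra begin

lemma subspace_bracket_span: "subspace (bracket_span A A')"
  by (simp add: bracket_span_def)

lemma bracket_span_mem: "x \<in> A \<Longrightarrow> y \<in> A \<Longrightarrow> bracket x y \<in> bracket_span A A"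
  unfolding bracket_span_def by (rule span_base) blast

lemma bracket_span_subset: "A \<subseteq> A' \<Longrightarrow> bracket_span A A \<subseteq> bracket_span A' A'"
  unfolding bracket_span_def by (rule span_mono) blast

text \<open>A set inside its own derived span survives in every term of the derived series.\<close>

lemma solvable_not_perfect:
  assumes "solvable I" "N \<subseteq> I" "N \<subseteq> bracket_span N N"
  shows "N \<subseteq> {0}"
proof -
  have "N \<subseteq> ((\<lambda>D. bracket_span D D) ^^ n) I" for n
  proof (induction n)
    case (Suc n)
    then show ?case using assms(3) bracket_span_subset[OF Suc] by auto
  qed (use assms(2) in simp)
  then show ?thesis using assms(1) unfolding solvable_def by metis
qed

lemma simple_perfect:
  assumes "simple S"
  shows "S \<subseteq> bracket_span S S"
proof -
  have S: "subalgebra S" "subspace S" using assms unfolding simple_def subalgebra_def by blast+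
  have sub: "bracket_span S S \<subseteq> S"
    unfolding bracket_span_def using S by (intro span_minimal) (auto simp: subalgebra_def)
  have "ideal_of (bracket_span S S) S"
    unfolding ideal_of_def using sub bracket_span_mem subspace_bracket_span by blast
  then have "bracket_span S S = {0} \<or> bracket_span S S = S" using assms unfolding simple_def by blast
  moreover have "bracket_span S S \<noteq> {0}"
    using assms bracket_span_mem[of _ S] unfolding simple_def abelian_def by blast
  ultimately show ?thesis by blast
qed

end

context char0_lie_algebra begin

text \<open>An eigenvector of a diagonalizable map involves only the basis vectors that have its eigenvalue.\<close>

lemma eigen_coefficient:
  assumes B: "independent B" "x \<in> span B" and h: "\<And>b. b \<in> B \<Longrightarrow> bracket h b = c b *s b"
    and x: "bracket h x = a *s x" and b: "b \<in> B" "representation B x b \<noteq> 0"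
  shows "c b = a"
proof -
  have fin: "finite B" by (rule finiteI_independent[OF B(1)])
  have "representation B (bracket h x) b
      = (\<Sum>b'\<in>B. representation B x b' * representation B (bracket h b') b)"
    by (rule representation_image[OF B(1) B(1) endo_bracket _ B(2)])
       (auto simp: h intro: span_scale span_base)
  also have "\<dots> = (\<Sum>b'\<in>B. if b' = b then representation B x b * c b else 0)"
    using B(1) h by (intro sum.cong) (auto simp: representation_scale representation_basis span_base)
  also have "\<dots> = representation B x b * c b" using b fin by simp
  finally have "a * representation B x b = representation B x b * c b"
    using x B by (simp add: representation_scale)
  then show ?thesis using b by simp
qed

text \<open>A special case of Cartan's criterion, proved over the ground field itself, where \<open>h\<close> is
diagonalizable. Let \<open>D\<close> act on the \<open>c\<close>-eigenspace of \<open>h\<close> as the rational scalar \<open>\<phi> c\<close>;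
additivity of \<open>\<phi>\<close> makes \<open>D\<close> a derivation of \<open>S\<close>. For \<open>x, y \<in> S\<close> one has
\<open>tr (ad [x, y] \<circ> D) = - tr (ad x \<circ> ad (D y))\<close>, so if the trace form were zero then \<open>tr (ad h \<circ> D)\<close> would vanish, \<open>S\<close>
being perfect. But \<open>\<phi>\<close> maps this trace to a sum of squares of rationals that are not all zero.\<close>

lemma trace_form_nonzero:
  assumes S: "subalgebra S" and perfect: "S \<subseteq> bracket_span S S"
    and B: "independent B" "span B = S"
    and h: "h \<in> S" "\<And>b. b \<in> B \<Longrightarrow> bracket h b = c b *s b" and b0: "b0 \<in> B" "c b0 \<noteq> 0"
  shows "\<exists>x\<in>S. \<exists>y\<in>S. trace_form B x y \<noteq> 0"
proof (rule ccontr)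
  assume "\<not> ?thesis"
  then have zero: "trace_form B x y = 0" if "x \<in> S" "y \<in> S" for x y using that by blast
  obtain \<phi> :: "'k \<Rightarrow> rat" where \<phi>: "\<And>x y. \<phi> (x + y) = \<phi> x + \<phi> y"
    "\<And>q x. \<phi> (of_rat q * x) = q * \<phi> x" "\<phi> (c b0) = 1"
    using rational_functional[OF b0(2)] by metis
  have sub: "subspace S" using S unfolding subalgebra_def by blast
  have BS: "b \<in> S" if "b \<in> B" for b using that B(2) span_base by blast
  have fin: "finite B" by (rule finiteI_independent[OF B(1)])
  define D where "D = pair.construct B (\<lambda>b. of_rat (\<phi> (c b)) *s b)"
  have endoD: "endo D" unfolding D_def by (rule pair.linear_construct[OF B(1)])
  have Db: "D b = of_rat (\<phi> (c b)) *s b" if "b \<in> B" for b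
    unfolding D_def by (rule pair.construct_basis[OF B(1) that])
  have Dweight: "D x = of_rat (\<phi> a) *s x" if x: "x \<in> S" "bracket h x = a *s x" for x a
  proof -
    have xB: "x \<in> span B" using x B by simp
    have xsum: "x = (\<Sum>b\<in>B. representation B x b *s b)"
      using sum_representation_eq[OF B(1) xB fin order_refl] by simp
    have eq: "representation B x b *s D b = representation B x b *s (of_rat (\<phi> a) *s b)" if "b \<in> B" for b
      using eigen_coefficient[OF B(1) xB h(2) x(2) that] Db[OF that]
      by (cases "representation B x b = 0") auto
    have "D x = (\<Sum>b\<in>B. representation B x b *s D b)"
      by (subst xsum) (simp add: pair.linear_sum[OF endoD] endo_simps[OF endoD])
    also have "\<dots> = (\<Sum>b\<in>B. representation B x b *s (of_rat (\<phi> a) *s b))"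
      using eq by (intro sum.cong) auto
    also have "\<dots> = of_rat (\<phi> a) *s (\<Sum>b\<in>B. representation B x b *s b)"
      by (simp add: scale_sum_right mult.commute)
    finally show ?thesis by (simp only: xsum[symmetric])
  qed
  have DS: "D x \<in> S" if "x \<in> S" for x
  proof -
    have "D x \<in> D ` span B" using that B by blast
    also have "\<dots> = span (D ` B)" using pair.linear_span_image[OF endoD] by simp
    also have "\<dots> \<subseteq> S" using Db BS sub by (intro span_minimal) (auto simp: subspace_scale)
    finally show ?thesis .
  qed
  have derB: "D (bracket b b') = bracket (D b) b' + bracket b (D b')" if "b \<in> B" "b' \<in> B" for b b'
  proof -
    have "bracket h (bracket b b') = (c b + c b') *s bracket b b'"
      using that by (simp add: bracket_derivation[of h] h(2) bracket_scale_left bracket_scale_right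
          scale_left_distrib)
    then have "D (bracket b b') = of_rat (\<phi> (c b + c b')) *s bracket b b'"
      using that BS S by (intro Dweight) (auto intro: subalgebra_mem)
    then show ?thesis
      using that by (simp add: Db \<phi>(1) of_rat_add bracket_scale_left bracket_scale_right scale_left_distrib)
  qed
  have derB': "D (bracket b y) = bracket (D b) y + bracket b (D y)" if "b \<in> B" "y \<in> S" for b y
    using pair.linear_eq_on[OF endo_comp[OF endoD endo_bracket]
        endo_add[OF endo_bracket endo_comp[OF endo_bracket endoD]], of y B b "D b" b] that B derB by blast
  have der: "D (bracket x y) = bracket (D x) y + bracket x (D y)" if "x \<in> S" "y \<in> S" for x y
    using pair.linear_eq_on[OF endo_comp[OF endoD endo_bracket_left]
        endo_add[OF endo_comp[OF endo_bracket_left endoD] endo_bracket_left], of x B y y "D y"] that B derB' by blast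
  define L where "L g = trace_on B (\<lambda>v. bracket g (D v))" for g
  have Lbr: "L (bracket x y) = 0" if x: "x \<in> S" and y: "y \<in> S" for x y
  proof -
    let ?t = "trace_on B"
    have "L (bracket x y) = ?t (\<lambda>v. bracket x (bracket y (D v))) - ?t (\<lambda>v. bracket y (bracket x (D v)))"
    proof -
      have "L (bracket x y) = ?t (\<lambda>v. bracket x (bracket y (D v)) - bracket y (bracket x (D v)))"
        unfolding L_def by (rule trace_on_cong) (simp add: bracket_derivation[of x y])
      then show ?thesis
        using x y S B BS DS by (simp add: trace_on_diff subalgebra_mem)
    qed
    also have "?t (\<lambda>v. bracket y (bracket x (D v))) = ?t (\<lambda>v. bracket x (D (bracket y v)))"
      by (rule trace_on_commute[OF B(1) B(1), of "bracket y" "\<lambda>v. bracket x (D v)"])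
         (use x y B S DS in \<open>auto intro: endo_bracket endo_comp endoD subalgebra_mem\<close>)
    also have "?t (\<lambda>v. bracket x (bracket y (D v))) - ?t (\<lambda>v. bracket x (D (bracket y v)))
        = ?t (\<lambda>v. bracket x (bracket y (D v)) - bracket x (D (bracket y v)))"
      by (rule trace_on_diff[OF B(1), symmetric])
         (use x y B S BS DS in \<open>auto intro: subalgebra_mem\<close>)
    also have "\<dots> = ?t (\<lambda>v. (-1) *s bracket x (bracket (D y) v))"
      by (rule trace_on_cong) (use der[OF y] BS in \<open>simp add: bracket_simps\<close>)
    also have "\<dots> = - trace_form B x (D y)"
      unfolding trace_form_def
      by (subst trace_on_scale[OF B(1)]) (use x y B S BS DS in \<open>auto intro: subalgebra_mem\<close>)
    finally show ?thesis using zero x DS y by simp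
  qed
  have Llin: "L (r *s x + y) = r * L x + L y" if "x \<in> S" "y \<in> S" for r x y
    unfolding L_def bracket_add_left bracket_scale_left
    by (subst trace_on_add[OF B(1)], (use that B S BS DS sub in \<open>auto intro: subalgebra_mem subspace_scale\<close>)[2])
       (subst trace_on_scale[OF B(1)], use that B S BS DS in \<open>auto intro: subalgebra_mem\<close>)
  have "x \<in> S \<and> L x = 0" if "x \<in> bracket_span S S" for x
    using that unfolding bracket_span_def
  proof (induction rule: span_induct_alt)
    case base
    then show ?case using Lbr[OF h(1) h(1)] sub by (simp add: bracket_self subspace_0)
  next
    case (step r x y)
    then have x: "x \<in> S" "L x = 0" using S Lbr by (auto intro: subalgebra_mem)
    then show ?case using step sub by (simp add: Llin subspace_add subspace_scale)
  qed
  then have "L h = 0" using h(1) perfect by blast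
  moreover have "L h = (\<Sum>b\<in>B. of_rat (\<phi> (c b)) * c b)"
    unfolding L_def trace_on_def
    by (intro sum.cong refl)
       (simp add: Db bracket_scale_right h(2) representation_scale B representation_basis BS sub subspace_scale)
  ultimately have L0: "(\<Sum>b\<in>B. of_rat (\<phi> (c b)) * c b) = 0" by simp
  \<comment> \<open>The scalars \<open>\<phi> (c b)\<close> are rational, so \<open>\<phi>\<close> passes through them.\<close>
  have \<phi>sum: "\<phi> (\<Sum>b\<in>B'. of_rat (\<phi> (c b)) * c b) = (\<Sum>b\<in>B'. \<phi> (c b) * \<phi> (c b))" if "finite B'" for B'
    using that
  proof (induction B' rule: finite_induct)
    case empty
    then show ?case using \<phi>(2)[of 0 0] by simp
  next
    case (insert b B')
    show ?case by (simp only: sum.insert[OF insert(1,2)] \<phi>(1,2) insert(3))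
  qed
  have "(\<Sum>b\<in>B. \<phi> (c b) * \<phi> (c b)) = 0"
    using \<phi>sum[OF fin] \<phi>(2)[of 0 0] unfolding L0 by simp
  then have "\<phi> (c b0) * \<phi> (c b0) = 0"
    using b0(1) fin by (subst (asm) sum_nonneg_eq_0_iff) auto
  then show False using \<phi>(3) by simp
qed

text \<open>By invariance the radical of the form is an ideal.\<close>

lemma simple_trace_form_nondegenerate:
  assumes simple: "simple S" and B: "independent B" "span B = S"
    and ne: "\<exists>x\<in>S. \<exists>y\<in>S. trace_form B x y \<noteq> 0"
    and x: "x \<in> S" "\<forall>y\<in>S. trace_form B x y = 0"
  shows "x = 0"
proof -
  have S: "subalgebra S" "subspace S" using simple unfolding simple_def subalgebra_def by blast+
  note bil = trace_form_bilinear[OF S(1) B] and inv = trace_form_invariant[OF S(1) B]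
  define R where "R = {x \<in> S. \<forall>y\<in>S. trace_form B x y = 0}"
  have "ideal_of R S"
    unfolding ideal_of_def
  proof (intro conjI ballI)
    have "trace_form B 0 y = 0" if "y \<in> S" for y using bil(3)[of y y 0] that by simp
    then show "subspace R" unfolding R_def using S(2) bil
      by (intro subspaceI) (auto simp: subspace_0 subspace_add subspace_scale)
    show "R \<subseteq> S" unfolding R_def by blast
    fix z r assume z: "z \<in> S" and r: "r \<in> R"
    have rS: "r \<in> S" using r R_def by simp
    have "trace_form B (bracket z r) y = 0" if y: "y \<in> S" for y
    proof -
      have "trace_form B (bracket r z) y = 0"
        using inv[OF rS z y] r y z S(1) by (simp add: R_def subalgebra_mem)
      moreover have "bracket z r = (-1) *s bracket r z" by (simp add: bracket_commute[of z r])
      ultimately show ?thesis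
        using bil(3)[of "bracket r z" y "-1"] rS z y S(1) by (simp add: subalgebra_mem)
    qed
    then show "bracket z r \<in> R" using z rS S(1) by (simp add: R_def subalgebra_mem)
  qed
  then have "R = {0} \<or> R = S" using simple unfolding simple_def by blast
  then show ?thesis using ne x R_def by blast
qed

text \<open>Morozov's lemma. The multiple \<open>z' = -2z\<close> makes \<open>h = [e, z']\<close> satisfy \<open>[h, e] = 2e\<close>, so \<open>z'\<close> is a candidate
for \<open>f\<close> that fails only by the error \<open>[h, z'] + 2z'\<close>, which lies in \<open>ker (ad e)\<close>. The error can be corrected within
\<open>ker (ad e)\<close> because \<open>ad h + 2\<close> is bijective there: a kernel vector of weight \<open>-2\<close> would be in the image of
every power of the nilpotent operator \<open>ad e\<close>.\<close>

lemma sl2_triple_of_double_bracket: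
  assumes S: "subalgebra S" and e: "e \<in> S" and nil: "\<And>x. (bracket e ^^ N) x = 0"
    and z: "z \<in> S" "bracket e (bracket e z) = e"
  shows "\<exists>h\<in>S. \<exists>f\<in>S. bracket h e = 2 *s e \<and> bracket h f = (-2) *s f \<and> bracket e f = h"
proof -
  have sub: "subspace S" using S unfolding subalgebra_def by blast
  define z' where "z' = (-2) *s z"
  define h where "h = bracket e z'"
  have z'S: "z' \<in> S" unfolding z'_def using z sub by (simp only: subspace_scale)
  have hS: "h \<in> S" unfolding h_def using e z'S S by (simp add: subalgebra_mem)
  have eh: "bracket e h = (-2) *s e" unfolding h_def z'_def
    by (simp only: bracket_scale_right z(2))
  have he: "bracket h e = 2 *s e" using bracket_commute[of h e] eh by simp
  let ?A = "bracket e" and ?H = "bracket h" and ?Z = "bracket z'"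
  have AZ: "?A (?Z x) = ?Z (?A x) + ?H x" for x
    using bracket_derivation[of e z' x] by (simp add: h_def add.commute)
  have HA: "?H (?A x) = ?A (?H x) + 2 *s ?A x" for x
    using bracket_derivation[of h e x] by (simp add: he bracket_scale_left add.commute)
  define U where "U = {x \<in> S. ?A x = 0}"
  have U: "subspace U" unfolding U_def using sub
    by (intro subspaceI) (auto simp: bracket_simps subspace_0 subspace_add subspace_scale)
  define M where "M x = ?H x + 2 *s x" for x
  have endoM: "endo M" unfolding M_def
    by (rule endoI) (simp_all add: bracket_simps scale_right_distrib algebra_simps)
  have MU: "M ` U \<subseteq> U"
  proof
    fix y assume "y \<in> M ` U"
    then obtain x where x: "x \<in> S" "?A x = 0" "y = ?H x + 2 *s x" by (auto simp: U_def M_def)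
    have "?A (?H x) = 0" using HA[of x] x(2) by (simp add: bracket_simps)
    then show "y \<in> U" using x S sub hS
      by (simp add: U_def bracket_simps subspace_add subspace_scale subalgebra_mem)
  qed
  \<comment> \<open>If \<open>v\<close> is in the kernel of \<open>ad e\<close> and in the image of its \<open>k\<close>-th power, then \<open>[h, v] - k v\<close> is in the image of the next power; here it is \<open>-(k + 2) v\<close>.\<close>
  have ker: "v = 0" if v: "?A v = 0" "?H v = (-2) *s v" for v
  proof -
    have "\<exists>w. v = (?A ^^ k) w" for k
    proof (induction k)
      case (Suc k)
      then obtain w where w: "v = (?A ^^ k) w" by blast
      have "(?A ^^ Suc k) w = 0" using v(1) w by simp
      then have "(?A ^^ Suc k) (?Z w) = of_nat (Suc k) *s (?H v - of_nat k *s v)"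
        using sl2_power_commute[of ?A ?Z ?H, OF endo_bracket AZ HA, of k w] w by (simp add: bracket_simps)
      also have "\<dots> = (- (of_nat (Suc k) * of_nat (k + 2))) *s v"
      proof -
        have "?H v - of_nat k *s v = (- of_nat (k + 2)) *s v"
          unfolding v(2) scale_left_diff_distrib[symmetric] by (simp del: scale_minus_left add: add.commute)
        then show ?thesis by (simp only: scale_scale mult_minus_right)
      qed
      finally have *: "(?A ^^ Suc k) (?Z w) = (- (of_nat (Suc k) * of_nat (k + 2))) *s v" .
      define r where "r = (- (of_nat (Suc k) * of_nat (k + 2)) :: 'k)"
      have "r \<noteq> 0" unfolding r_def by (simp del: of_nat_Suc of_nat_add)
      moreover have "(?A ^^ Suc k) (inverse r *s ?Z w) = inverse r *s (r *s v)"
        using * unfolding r_def[symmetric] by (simp only: endo_simps(3)[OF endo_funpow[OF endo_bracket]])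
      ultimately have "v = (?A ^^ Suc k) (inverse r *s ?Z w)" by simp
      then show ?case by blast
    qed simp
    then obtain w where "v = (?A ^^ N) w" by blast
    then show ?thesis using nil by simp
  qed
  have inj: "inj_on M U"
  proof (rule inj_onI)
    fix x y assume xy: "x \<in> U" "y \<in> U" "M x = M y"
    have "M (x - y) = 0" using xy(3) by (simp add: endo_simps[OF endoM])
    then have "?H (x - y) = (-2) *s (x - y)" unfolding M_def by (simp add: eq_neg_iff_add_eq_0)
    moreover have "?A (x - y) = 0" using xy by (simp add: U_def bracket_simps)
    ultimately show "x = y" using ker by fastforce
  qed
  have spU: "span U = U" using U by simp
  have "dim (M ` U) = dim U" by (rule pair.dim_image_eq[OF endoM]) (unfold spU, rule inj)
  then have surj: "M ` U = U"
    using subspace_dim_equal[OF pair.linear_subspace_image[OF endoM U] U MU] by simp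
  have "?A (M z') = 0"
    using HA[of z'] by (simp add: M_def bracket_simps h_def[symmetric] eh bracket_self)
  then have "M z' \<in> U" using z'S hS S sub
    by (simp add: U_def M_def subspace_add subspace_scale subalgebra_mem)
  then obtain w where w: "w \<in> U" "M w = M z'" using surj by (metis imageE)
  define f where "f = z' - w"
  have "M f = 0" using w(2) by (simp add: f_def endo_simps[OF endoM])
  then have hf: "?H f = (-2) *s f" unfolding M_def by (simp add: eq_neg_iff_add_eq_0)
  have "bracket e f = h" using w(1) by (simp add: f_def bracket_simps h_def U_def)
  moreover have "f \<in> S" using w(1) z'S sub by (simp add: f_def U_def subspace_diff)
  ultimately show ?thesis using he hf hS by blast
qed

text \<open>By the preceding lemma \<open>e\<close> only has to lie in the image \<open>W\<close> of \<open>(ad e)\<^sup>2\<close> on \<open>S\<close>. Otherwise some \<open>z\<close> is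
orthogonal to \<open>W\<close> but not to \<open>e\<close>. Orthogonality to \<open>W\<close> means \<open>[e, [e, z]] = 0\<close>, so that \<open>ad e\<close> commutes with
\<open>[ad e, ad z]\<close>, and \<open>ad e \<circ> ad z\<close> is nilpotent by \<open>nilpotent_product\<close>; its trace is zero, a contradiction.\<close>

theorem jacobson_morozov:
  assumes S: "subalgebra S" and B: "independent B" "span B = S"
    and nondeg: "\<And>x. x \<in> S \<Longrightarrow> \<forall>y\<in>S. trace_form B x y = 0 \<Longrightarrow> x = 0"
    and e: "e \<in> S" and nil: "\<And>x. (bracket e ^^ N) x = 0"
  shows "\<exists>h\<in>S. \<exists>f\<in>S. bracket h e = 2 *s e \<and> bracket h f = (-2) *s f \<and> bracket e f = h"
proof -
  have sub: "subspace S" using S unfolding subalgebra_def by blast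
  note bil = trace_form_bilinear[OF S B] and inv = trace_form_invariant[OF S B]
    and sym = trace_form_sym[OF S B]
  define W where "W = (\<lambda>x. bracket e (bracket e x)) ` S"
  have W: "subspace W" unfolding W_def
    by (rule pair.linear_subspace_image[OF endo_comp[OF endo_bracket endo_bracket] sub])
  have WS: "W \<subseteq> S" unfolding W_def using e S by (auto intro: subalgebra_mem)
  have "e \<in> W"
  proof (rule ccontr)
    assume ne: "e \<notin> W"
    have "\<exists>z\<in>S. trace_form B z e \<noteq> 0 \<and> (\<forall>w\<in>W. trace_form B z w = 0)"
      by (rule nondegenerate_separates[of S "trace_form B" W e])
         ((rule bil nondeg sub W WS e ne; assumption) | blast)+
    then obtain z where z: "z \<in> S" "trace_form B z e \<noteq> 0" "\<And>w. w \<in> W \<Longrightarrow> trace_form B z w = 0"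
      by blast
    have ez: "bracket e z \<in> S" using e z(1) S by (simp add: subalgebra_mem)
    have "trace_form B (bracket e (bracket e z)) y = 0" if y: "y \<in> S" for y
    proof -
      have ze: "bracket z e \<in> S" using e z(1) S by (simp add: subalgebra_mem)
      have "bracket e (bracket e z) = bracket (bracket z e) e"
        using bracket_commute[of e z] bracket_commute[of e "bracket z e"] by (simp add: bracket_simps)
      then have "trace_form B (bracket e (bracket e z)) y = trace_form B z (bracket e (bracket e y))"
        using inv[OF ze e y] inv[OF z(1) e, of "bracket e y"] e y S by (simp add: subalgebra_mem)
      also have "\<dots> = 0" by (rule z(3)) (use y W_def in blast)
      finally show ?thesis .
    qed
    then have eez: "bracket e (bracket e z) = 0"
      using nondeg[OF subalgebra_mem[OF S e ez]] by blast
    have "trace_form B e z = 0"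
      unfolding trace_form_def
    proof (rule trace_on_nilpotent[OF B(1)])
      show "endo (\<lambda>v. bracket e (bracket z v))" by (rule endo_comp[OF endo_bracket endo_bracket])
      show "bracket e (bracket z x) \<in> span B" if "x \<in> span B" for x
        using that e z(1) S B by (auto intro: subalgebra_mem)
      show "((\<lambda>v. bracket e (bracket z v)) ^^ (N * N)) x = 0" for x
      proof (rule nilpotent_product[OF endo_bracket endo_bracket endo_bracket[of "bracket e z"] _ _ nil])
        show "bracket e (bracket z x) = bracket z (bracket e x) + bracket (bracket e z) x" for x
          using bracket_derivation[of e z x] by (simp add: add.commute)
        show "bracket e (bracket (bracket e z) x) = bracket (bracket e z) (bracket e x)" for x
          using bracket_derivation[of e "bracket e z" x] by (simp add: eez bracket_left_simps)
      qed
    qed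
    then show False using sym[OF e z(1)] z(2) by simp
  qed
  then obtain z where "z \<in> S" "bracket e (bracket e z) = e" by (auto simp: W_def)
  then show ?thesis using sl2_triple_of_double_bracket[OF S e nil] by blast
qed

end

section \<open>Highest weight vectors\<close>

locale sl2_action = char0_space scale Basis
  for scale :: "'k::field_char_0 \<Rightarrow> 'v::ab_group_add \<Rightarrow> 'v" (infixr \<open>*s\<close> 75)
    and Basis :: "'v set" +
  fixes E F H :: "'v \<Rightarrow> 'v"
  assumes E: "endo E" and F: "endo F" and H: "endo H"
    and EF: "E (F x) = F (E x) + H x"
    and HE: "H (E x) = E (H x) + 2 *s E x"
    and HF: "H (F x) = F (H x) - 2 *s F x"
begin

lemmas E_simps = endo_simps[OF E] and F_simps = endo_simps[OF F] and H_simps = endo_simps[OF H]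
lemmas Fpow_simps = endo_simps[OF endo_funpow[OF F]]

lemma E_nilpotent: "\<exists>n. \<forall>x. (E ^^ n) x = 0"
  by (rule weight_shift_nilpotent[OF E H HE]) simp

lemma F_nilpotent: "\<exists>n. \<forall>x. (F ^^ n) x = 0"
  by (rule weight_shift_nilpotent[OF F H, of "-2"]) (simp_all add: HF)

lemma H_F_power: "H ((F ^^ k) x) = (F ^^ k) (H x) - of_nat (2 * k) *s (F ^^ k) x"
proof (induction k)
  case (Suc k)
  show ?case
    by (simp add: HF Suc F_simps scale_left_distrib algebra_simps)
qed simp

lemma E_F_power:
  "E ((F ^^ Suc k) x) = (F ^^ Suc k) (E x) + of_nat (Suc k) *s (F ^^ k) (H x - of_nat k *s x)"
proof -
  have "(F ^^ Suc k) (E x)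
      = E ((F ^^ Suc k) x) + of_nat (Suc k) *s (- H ((F ^^ k) x) - of_nat k *s (F ^^ k) x)"
    by (rule sl2_power_commute[OF F]) (simp_all add: EF HF F_simps)
  moreover have "- H ((F ^^ k) x) - of_nat k *s (F ^^ k) x = - ((F ^^ k) (H x - of_nat k *s x))"
  proof -
    have "of_nat (2 * k) *s (F ^^ k) x = of_nat k *s (F ^^ k) x + of_nat k *s (F ^^ k) x"
      by (simp only: mult_2 of_nat_add scale_left_distrib)
    then show ?thesis unfolding H_F_power Fpow_simps by (simp only: minus_diff_eq) simp
  qed
  ultimately show ?thesis by (simp only: scale_minus_right) simp
qed

lemma E_F_power_weight:
  assumes "E v = 0" "H v = c *s v"
  shows "E ((F ^^ Suc k) v) = (of_nat (Suc k) * (c - of_nat k)) *s (F ^^ k) v"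
proof -
  have "H v - of_nat k *s v = (c - of_nat k) *s v" using assms(2) by (simp add: scale_left_diff_distrib)
  then show ?thesis
    using E_F_power[of k v] assms(1) by (simp del: funpow.simps of_nat_Suc add: Fpow_simps)
qed

text \<open>The operator \<open>H (H - 1) \<cdots> (H - (k - 1))\<close>.\<close>

fun falling_product :: "nat \<Rightarrow> 'v \<Rightarrow> 'v" where
  "falling_product 0 x = x"
| "falling_product (Suc k) x = falling_product k (H x - of_nat k *s x)"

lemma E_H_kernel: "E x = 0 \<Longrightarrow> E (H x) = 0"
  using HE[of x] by (simp add: H_simps)

text \<open>Nilpotency of \<open>F\<close> turns this into a polynomial equation for \<open>H\<close> on \<open>ker E\<close> with natural numbers as
roots. This is how integral weights appear without eigenvalues in an algebraic closure.\<close>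

lemma E_power_F_power:
  "E x = 0 \<Longrightarrow> (E ^^ k) ((F ^^ k) x) = fact k *s falling_product k x"
proof (induction k arbitrary: x)
  case (Suc k)
  let ?y = "H x - of_nat k *s x"
  have y: "E ?y = 0" using Suc.prems E_H_kernel[of x] by (simp add: E_simps)
  have "(E ^^ Suc k) ((F ^^ Suc k) x) = (E ^^ k) (E ((F ^^ Suc k) x))" by (simp only: funpow_Suc_right comp_apply)
  also have "\<dots> = (E ^^ k) (of_nat (Suc k) *s (F ^^ k) ?y)"
    unfolding E_F_power Suc.prems by (simp only: Fpow_simps add_0_left)
  also have "\<dots> = of_nat (Suc k) *s (fact k *s falling_product k ?y)"
    unfolding endo_simps(3)[OF endo_funpow[OF E]] Suc.IH[OF y] ..
  finally show ?case by simp
qed simp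

lemma falling_product_kernel:
  assumes "E x = 0"
  shows "\<exists>n. falling_product n x = 0"
proof -
  obtain n where "\<And>x. (F ^^ n) x = 0" using F_nilpotent by blast
  then have "fact n *s falling_product n x = 0"
    using E_power_F_power[OF assms, of n] by (simp add: endo_simps[OF endo_funpow[OF E]])
  then show ?thesis by auto
qed

text \<open>Peel off the factors of the annihilating product one at a time. The hypothesis \<open>H u \<noteq> 0\<close> ensures
that the factor \<open>H - 0\<close> is not the one at which the vector dies.\<close>

lemma positive_weight_in_kernel:
  assumes N: "subspace N" "\<And>x. x \<in> N \<Longrightarrow> H x \<in> N"
  shows "falling_product n u = 0 \<Longrightarrow> u \<in> N \<Longrightarrow> E u = 0 \<Longrightarrow> H u \<noteq> 0 \<Longrightarrow>
    \<exists>v\<in>N. \<exists>d\<ge>1. v \<noteq> 0 \<and> E v = 0 \<and> H v = of_nat d *s v"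
proof (induction n arbitrary: u)
  case 0
  then show ?case by (simp add: H_simps)
next
  case (Suc n)
  let ?w = "H u - of_nat n *s u"
  have w: "?w \<in> N" "E ?w = 0" "falling_product n ?w = 0"
    using Suc.prems N E_H_kernel[of u] by (simp_all add: E_simps subspace_diff subspace_scale)
  show ?case
  proof (cases "H ?w = 0")
    case False
    then show ?thesis using Suc.IH w by blast
  next
    case True
    then have eig: "H (H u) = of_nat n *s H u" by (simp add: H_simps)
    have "n \<noteq> 0"
    proof
      assume "n = 0"
      then show False using Suc.prems(1,4) by simp
    qed
    then show ?thesis
      using eig Suc.prems N(2) E_H_kernel[of u] by (intro bexI[of _ "H u"] exI[of _ n]) auto
  qed
qed

text \<open>If \<open>ker E\<close> contained no vector of positive weight, then \<open>H\<close> would be zero on \<open>ker E\<close>. Take \<open>v\<close> with \<open>E v \<noteq> 0\<close>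
and \<open>E (E v) = 0\<close>. Then \<open>E v\<close> is an invariant vector, \<open>H v\<close> has weight \<open>-2\<close>, and applying \<open>F\<close> to \<open>H v\<close> never reaches zero:
\<open>E\<close> multiplies the steps back by the nonzero scalars \<open>-(k + 1)(k + 2)\<close>. So \<open>F\<close> would not be nilpotent.\<close>

lemma highest_weight_vector_exists:
  assumes N: "subspace N" "\<And>x. x \<in> N \<Longrightarrow> E x \<in> N" "\<And>x. x \<in> N \<Longrightarrow> H x \<in> N"
      "\<And>x. x \<in> N \<Longrightarrow> F x \<in> N"
    and nontriv: "u \<in> N" "E u \<noteq> 0"
  shows "\<exists>v\<in>N. \<exists>d\<ge>1. v \<noteq> 0 \<and> E v = 0 \<and> H v = of_nat d *s v"
proof (rule ccontr)
  assume none: "\<not> ?thesis"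
  have H0: "H x = 0" if "x \<in> N" "E x = 0" for x
  proof (rule ccontr)
    assume "H x \<noteq> 0"
    then show False
      using falling_product_kernel[OF that(2)] positive_weight_in_kernel[OF N(1,3)] that none by metis
  qed
  obtain n where n: "(E ^^ n) u = 0" using E_nilpotent by blast
  define j where "j = (LEAST j. (E ^^ j) u = 0)"
  have j: "(E ^^ j) u = 0" unfolding j_def using n by (rule LeastI)
  have "j \<noteq> 0"
  proof
    assume "j = 0"
    then have "u = 0" using j by simp
    then show False using nontriv(2) by (simp add: E_simps)
  qed
  moreover have "j \<noteq> 1" using j nontriv(2) by auto
  ultimately obtain i where i: "j = Suc (Suc i)" by (metis One_nat_def not0_implies_Suc)
  define v where "v = (E ^^ i) u"
  have EEv: "E (E v) = 0" using j unfolding v_def i by simp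
  have Ev: "E v \<noteq> 0"
  proof
    assume "E v = 0"
    then have "(E ^^ Suc i) u = 0" unfolding v_def by simp
    then show False using not_less_Least[of "Suc i" "\<lambda>j. (E ^^ j) u = 0"] i unfolding j_def by simp
  qed
  have EpowN: "(E ^^ k) u \<in> N" for k by (induction k) (simp_all add: nontriv N)
  have vN: "v \<in> N" "E v \<in> N" using EpowN N(2) by (simp_all add: v_def)
  have HEv: "H (E v) = 0" using H0 vN EEv by blast
  have FEv: "F (E v) = 0"
  proof -
    have "E (F (E v)) = 0" using EF[of "E v"] EEv HEv by (simp add: F_simps)
    then have "H (F (E v)) = 0" using H0 vN N(4) by blast
    then show ?thesis using HF[of "E v"] HEv by (simp add: F_simps)
  qed
  let ?u = "H v"
  have EHv: "E ?u = (-2) *s E v" using HE[of v] HEv by (simp add: eq_neg_iff_add_eq_0)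
  have "E (?u + 2 *s v) = 0" by (simp add: E_simps EHv)
  then have "H (?u + 2 *s v) = 0" using H0 vN N by (simp add: subspace_add subspace_scale)
  then have Hu: "H ?u = (-2) *s ?u" by (simp add: H_simps eq_neg_iff_add_eq_0)
  have FEu: "F (E ?u) = 0" by (simp add: EHv F_simps FEv)
  have "E ?u \<noteq> 0" using EHv Ev by simp
  then have u0: "?u \<noteq> 0" by (metis E_simps(1))
  have E_Fu: "E ((F ^^ Suc k) ?u) = (- of_nat (Suc k * (k + 2))) *s (F ^^ k) ?u" for k
  proof -
    have "(F ^^ Suc k) (E ?u) = 0" using FEu by (simp add: funpow_swap1 Fpow_simps)
    moreover have "H ?u - of_nat k *s ?u = (- of_nat (k + 2)) *s ?u"
      unfolding Hu scale_left_diff_distrib[symmetric] by (simp del: scale_minus_left add: add.commute)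
    ultimately show ?thesis
      unfolding E_F_power by (simp only: Fpow_simps scale_scale add_0_left of_nat_mult mult_minus_right)
  qed
  have "(F ^^ k) ?u \<noteq> 0" for k
  proof (induction k)
    case (Suc k)
    have "- of_nat (Suc k * (k + 2)) \<noteq> (0 :: 'k)" by (simp del: of_nat_mult of_nat_add of_nat_Suc)
    then have "E ((F ^^ Suc k) ?u) \<noteq> 0" using E_Fu[of k] Suc by simp
    then show ?case by (metis E_simps(1))
  qed (use u0 in simp)
  then show False using F_nilpotent by blast
qed

text \<open>The first power of \<open>F\<close> that kills \<open>v\<close> is found by applying \<open>E\<close>: the scalar \<open>(k + 1)(d - k)\<close> must be zero.\<close>

lemma highest_weight_string:
  assumes v: "v \<noteq> 0" "E v = 0" "H v = of_nat d *s v"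
  shows "(F ^^ Suc d) v = 0" "i \<le> d \<Longrightarrow> (F ^^ i) v \<noteq> 0"
proof -
  define n where "n = (LEAST n. (F ^^ n) v = 0)"
  have n: "(F ^^ n) v = 0" unfolding n_def using F_nilpotent by (metis (mono_tags, lifting) LeastI)
  have less: "(F ^^ i) v \<noteq> 0" if "i < n" for i
    using that not_less_Least[of i "\<lambda>n. (F ^^ n) v = 0"] unfolding n_def by blast
  have "n \<noteq> 0" using n v(1) by (metis funpow_0)
  then obtain k where k: "n = Suc k" using not0_implies_Suc by blast
  have "(of_nat (Suc k) * (of_nat d - of_nat k)) *s (F ^^ k) v = 0"
    using E_F_power_weight[OF v(2,3), of k] n unfolding k by (simp only: E_simps)
  then have "of_nat (Suc k) * (of_nat d - of_nat k) = (0::'k)" using less[of k] k by simp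
  then have "k = d" by (simp del: of_nat_Suc)
  then show "(F ^^ Suc d) v = 0" "i \<le> d \<Longrightarrow> (F ^^ i) v \<noteq> 0" using n less k by simp_all
qed

end

section \<open>The irreducible modules in coordinates\<close>

text \<open>Matrices of \<open>e\<close>, \<open>f\<close>, \<open>h\<close> on the irreducible module of highest weight \<open>d\<close>, in the basis of a highest weight
vector and its images under the powers of \<open>f\<close>. The dimension is \<open>d + 1\<close>.\<close>

definition string_E :: "nat \<Rightarrow> (nat \<Rightarrow> 'k::field_char_0) \<Rightarrow> nat \<Rightarrow> 'k" where
  "string_E d x = (\<lambda>i. if i < d then of_nat (Suc i) * (of_nat d - of_nat i) * x (Suc i) else 0)"

definition string_F :: "nat \<Rightarrow> (nat \<Rightarrow> 'k::field_char_0) \<Rightarrow> nat \<Rightarrow> 'k" where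
  "string_F d x = (\<lambda>i. if 0 < i \<and> i \<le> d then x (i - 1) else 0)"

definition string_H :: "nat \<Rightarrow> (nat \<Rightarrow> 'k::field_char_0) \<Rightarrow> nat \<Rightarrow> 'k" where
  "string_H d x = (\<lambda>i. if i \<le> d then (of_nat d - 2 * of_nat i) * x i else 0)"

definition string_act :: "nat \<Rightarrow> 'k::field_char_0 ^ 2 ^ 2 \<Rightarrow> (nat \<Rightarrow> 'k) \<Rightarrow> nat \<Rightarrow> 'k" where
  "string_act d A x = coord_scale (A $ 1 $ 1) (string_H d x) + coord_scale (A $ 1 $ 2) (string_E d x)
     + coord_scale (A $ 2 $ 1) (string_F d x)"

lemma sl2_entry: "A \<in> sl2 \<Longrightarrow> A $ 2 $ 2 = - A $ 1 $ 1" for A :: "'k::field ^ 2 ^ 2"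
  by (simp add: sl2_def trace_def sum_2 eq_neg_iff_add_eq_0 add.commute)

lemma sl2_eqI:
  fixes A B :: "'k::field ^ 2 ^ 2"
  assumes "A \<in> sl2" "B \<in> sl2" "A $ 1 $ 1 = B $ 1 $ 1" "A $ 1 $ 2 = B $ 1 $ 2" "A $ 2 $ 1 = B $ 2 $ 1"
  shows "A = B"
  using assms sl2_entry[of A] sl2_entry[of B] by (simp add: vec_eq_iff forall_2)

lemma sl2_bracket_entries:
  assumes "A \<in> sl2" "B \<in> sl2"
  shows "sl2_bracket A B $ 1 $ 1 = A $ 1 $ 2 * B $ 2 $ 1 - B $ 1 $ 2 * A $ 2 $ 1"
    "sl2_bracket A B $ 1 $ 2 = 2 * (A $ 1 $ 1 * B $ 1 $ 2 - B $ 1 $ 1 * A $ 1 $ 2)"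
    "sl2_bracket A B $ 2 $ 1 = 2 * (B $ 1 $ 1 * A $ 2 $ 1 - A $ 1 $ 1 * B $ 2 $ 1)"
  using sl2_entry[OF assms(1)] sl2_entry[OF assms(2)]
  by (simp_all add: sl2_bracket_def matrix_matrix_mult_def sum_2 algebra_simps)

lemma sl2_closed:
  "A \<in> sl2 \<Longrightarrow> B \<in> sl2 \<Longrightarrow> A + B \<in> sl2" "A \<in> sl2 \<Longrightarrow> sl2_scale c A \<in> sl2"
  "sl2_bracket A B \<in> sl2"
  by (simp_all add: sl2_def sl2_scale_def sl2_bracket_def trace_def sum_2 matrix_matrix_mult_def
      algebra_simps flip: distrib_left)

lemma sl2_scale_entry: "sl2_scale c A $ i $ j = c * A $ i $ j"
  by (simp add: sl2_scale_def)

lemma vector_space_coord: "vector_space (coord_scale :: 'k::field \<Rightarrow> (nat \<Rightarrow> 'k) \<Rightarrow> _)"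
  by unfold_locales (simp_all add: coord_scale_def fun_eq_iff algebra_simps)

lemma coord_space_closed:
  "0 \<in> coord_space n"
  "x \<in> coord_space n \<Longrightarrow> y \<in> coord_space n \<Longrightarrow> x + y \<in> coord_space n"
  "x \<in> coord_space n \<Longrightarrow> y \<in> coord_space n \<Longrightarrow> x - y \<in> coord_space n"
  "x \<in> coord_space n \<Longrightarrow> coord_scale c x \<in> coord_space n"
  by (simp_all add: coord_space_def coord_scale_def)

lemma string_closed:
  "string_E d x \<in> coord_space (Suc d)" "string_F d x \<in> coord_space (Suc d)"
  "string_H d x \<in> coord_space (Suc d)" "string_act d A x \<in> coord_space (Suc d)"
  by (simp_all add: string_E_def string_F_def string_H_def string_act_def coord_space_def coord_scale_def)

lemma string_add:
  "string_E d (x + y) = string_E d x + string_E d y" "string_F d (x + y) = string_F d x + string_F d y"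
  "string_H d (x + y) = string_H d x + string_H d y"
  by (auto simp: string_E_def string_F_def string_H_def fun_eq_iff algebra_simps)

lemma string_scale:
  "string_E d (coord_scale c x) = coord_scale c (string_E d x)"
  "string_F d (coord_scale c x) = coord_scale c (string_F d x)"
  "string_H d (coord_scale c x) = coord_scale c (string_H d x)"
  by (auto simp: string_E_def string_F_def string_H_def coord_scale_def fun_eq_iff)

lemma coord_space_top:
  fixes x :: "nat \<Rightarrow> 'k::field"
  assumes "x \<in> coord_space (Suc d)" "x \<noteq> 0"
  shows "\<exists>k. x k \<noteq> 0 \<and> k \<le> d \<and> (\<forall>i>k. x i = 0)"
proof -
  have fin: "{i. x i \<noteq> 0} \<subseteq> {..d}" "{i. x i \<noteq> 0} \<noteq> {}"
    using assms unfolding coord_space_def by (force simp: not_less_eq_eq, auto simp: fun_eq_iff)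
  then have f: "finite {i. x i \<noteq> 0}" using finite_subset by blast
  define k where "k = Max {i. x i \<noteq> 0}"
  have k: "x k \<noteq> 0" using Max_in[OF f fin(2)] by (simp add: k_def)
  moreover have "x i = 0" if "i > k" for i using Max_ge[OF f, of i] that unfolding k_def by force
  ultimately show ?thesis using fin(1) by blast
qed

lemma string_E_top:
  assumes "x (Suc k) \<noteq> 0" "\<And>i. i > Suc k \<Longrightarrow> x i = 0" "k < d"
  shows "string_E d x k \<noteq> 0" "i > k \<Longrightarrow> string_E d x i = 0"
proof -
  have "of_nat d - of_nat k \<noteq> (0::'a)" using assms(3) by simp
  then show "string_E d x k \<noteq> 0" using assms(1,3) by (simp add: string_E_def del: of_nat_Suc)
  show "i > k \<Longrightarrow> string_E d x i = 0" using assms(2) by (simp add: string_E_def)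
qed

lemma string_EF: "string_E d (string_F d x) = string_F d (string_E d x) + string_H d x"
proof
  fix i
  consider "i < d" | "i = d" | "i > d" by linarith
  then show "string_E d (string_F d x) i = (string_F d (string_E d x) + string_H d x) i"
    by cases (cases i; simp add: string_E_def string_F_def string_H_def algebra_simps)+
qed

lemma string_HE: "string_H d (string_E d x) = string_E d (string_H d x) + coord_scale 2 (string_E d x)"
  by (auto simp: string_E_def string_H_def coord_scale_def fun_eq_iff algebra_simps)

lemma string_HF: "string_H d (string_F d x) = string_F d (string_H d x) + coord_scale (-2) (string_F d x)"
proof
  fix i
  show "string_H d (string_F d x) i = (string_F d (string_H d x) + coord_scale (-2) (string_F d x)) i"
    by (cases i) (simp_all add: string_F_def string_H_def coord_scale_def algebra_simps)
qed

lemma sl2_module_string: "sl2_module (Suc d) (string_act d)"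
  unfolding sl2_module_def
proof (intro conjI ballI allI)
  fix A B :: "'a ^ 2 ^ 2" and v w :: "nat \<Rightarrow> 'a" and c :: 'a
  show "string_act d A v \<in> coord_space (Suc d)" by (rule string_closed)
  show "string_act d A (v + w) = string_act d A v + string_act d A w"
    by (simp add: string_act_def string_add) (simp add: fun_eq_iff coord_scale_def algebra_simps)
  show "string_act d A (coord_scale c v) = coord_scale c (string_act d A v)"
    by (simp add: string_act_def string_scale) (simp add: fun_eq_iff coord_scale_def algebra_simps)
  show "string_act d (A + B) v = string_act d A v + string_act d B v"
    by (simp add: string_act_def fun_eq_iff coord_scale_def algebra_simps)
  show "string_act d (sl2_scale c A) v = coord_scale c (string_act d A v)"
    by (simp add: string_act_def fun_eq_iff coord_scale_def algebra_simps sl2_scale_entry)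
  assume "A \<in> sl2" "B \<in> sl2"
  then show "string_act d (sl2_bracket A B) v
      = string_act d A (string_act d B v) - string_act d B (string_act d A v)"
    by (simp add: string_act_def sl2_bracket_entries string_add string_scale string_EF string_HE string_HF)
       (simp add: fun_eq_iff coord_scale_def algebra_simps)
qed

definition unit_coord :: "nat \<Rightarrow> nat \<Rightarrow> 'k::field" where
  "unit_coord i = (\<lambda>j. if j = i then 1 else 0)"

definition sl2_e :: "'k::field ^ 2 ^ 2" where "sl2_e = (\<chi> i j. if i = 1 \<and> j = 2 then 1 else 0)"
definition sl2_f :: "'k::field ^ 2 ^ 2" where "sl2_f = (\<chi> i j. if i = 2 \<and> j = 1 then 1 else 0)"

lemma string_act_generators:
  "string_act d sl2_e x = string_E d x" "string_act d sl2_f x = string_F d x"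
  "sl2_e \<in> sl2" "sl2_f \<in> sl2"
  by (simp_all add: string_act_def sl2_e_def sl2_f_def coord_scale_def fun_eq_iff sl2_def trace_def sum_2)

text \<open>Repeated use of \<open>e\<close> moves any nonzero vector of a submodule to the highest weight line, and \<open>f\<close> then
produces the whole basis; the scalars that occur are nonzero in characteristic zero.\<close>

lemma is_v_string: "is_v (Suc d) (string_act d :: 'k::field_char_0 ^ 2 ^ 2 \<Rightarrow> _)"
  unfolding is_v_def
proof (intro conjI allI impI)
  interpret C: vector_space "coord_scale :: 'k \<Rightarrow> (nat \<Rightarrow> 'k) \<Rightarrow> _" by (rule vector_space_coord)
  show "sl2_module (Suc d) (string_act d :: 'k ^ 2 ^ 2 \<Rightarrow> _)" by (rule sl2_module_string)
  fix W :: "(nat \<Rightarrow> 'k) set"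
  assume "C.subspace W \<and> W \<subseteq> coord_space (Suc d) \<and> (\<forall>A\<in>sl2. \<forall>w\<in>W. string_act d A w \<in> W)"
  then have W: "C.subspace W" "W \<subseteq> coord_space (Suc d)"
    and inv: "\<And>w. w \<in> W \<Longrightarrow> string_E d w \<in> W" "\<And>w. w \<in> W \<Longrightarrow> string_F d w \<in> W"
    using string_act_generators by metis+
  \<comment> \<open>Induction on the largest index of a nonzero coordinate, which \<open>e\<close> lowers by one.\<close>
  have unit0: "unit_coord 0 \<in> W" if "x \<in> W" "x k \<noteq> 0" "\<And>i. i > k \<Longrightarrow> x i = 0" for x k
    using that
  proof (induction k arbitrary: x)
    case 0
    have "unit_coord 0 = coord_scale (inverse (x 0)) x"
      using 0 by (auto simp: unit_coord_def coord_scale_def fun_eq_iff)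
    then show ?case using C.subspace_scale[OF W(1) 0(1)] by simp
  next
    case (Suc k)
    have "Suc k < Suc d" using Suc.prems(1,2) W(2) unfolding coord_space_def by (force simp: not_less[symmetric])
    then have k: "k < d" by simp
    have "string_E d x k \<noteq> 0" "\<And>i. i > k \<Longrightarrow> string_E d x i = 0"
      using string_E_top[of x k d] Suc.prems(2,3) k by auto
    then show ?case using Suc.IH inv(1)[OF Suc.prems(1)] by blast
  qed
  show "W = {0} \<or> W = coord_space (Suc d)"
  proof (cases "W \<subseteq> {0}")
    case True
    then show ?thesis using C.subspace_0[OF W(1)] by blast
  next
    case False
    then obtain x where x: "x \<in> W" "x \<noteq> 0" by blast
    then obtain k where "x k \<noteq> 0" "\<And>i. i > k \<Longrightarrow> x i = 0"
      using coord_space_top[of x d] W(2) by blast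
    then have u0: "unit_coord 0 \<in> W" using unit0 x(1) by blast
    have unit: "unit_coord i \<in> W" if "i \<le> d" for i
      using that
    proof (induction i)
      case (Suc i)
      have "unit_coord (Suc i) = string_F d (unit_coord i :: nat \<Rightarrow> 'k)"
        using Suc.prems by (auto simp: unit_coord_def string_F_def fun_eq_iff)
      then show ?case using inv(2) Suc by simp
    qed (rule u0)
    have "y \<in> W" if y: "y \<in> coord_space (Suc d)" for y
    proof -
      have "(\<Sum>i\<in>A. coord_scale (y i) (unit_coord i)) j = (if j \<in> A then y j else 0)" if "finite A" for A j
        using that by (induction A rule: finite_induct) (auto simp: coord_scale_def unit_coord_def)
      then have "y = (\<Sum>i\<le>d. coord_scale (y i) (unit_coord i))"
        using y by (auto simp: fun_eq_iff coord_space_def)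
      moreover have "(\<Sum>i\<le>d. coord_scale (y i) (unit_coord i)) \<in> W"
        using unit by (intro C.subspace_sum[OF W(1)] C.subspace_scale[OF W(1)]) simp
      ultimately show ?thesis by simp
    qed
    then show ?thesis using W(2) by blast
  qed
qed simp

text \<open>It is easier to write down a parametrization \<open>g\<close> of a subalgebra by the model than the coordinate map
that the definition of isomorphism asks for.\<close>

lemma (in lie_algebra) subalgebra_isomorphic_image:
  fixes scale' :: "'k \<Rightarrow> 'w::ab_group_add \<Rightarrow> 'w"
  assumes inj: "inj_on g L" and ne: "L \<noteq> {}"
    and closed: "\<And>x y. x \<in> L \<Longrightarrow> y \<in> L \<Longrightarrow> x + y \<in> L" "\<And>c x. x \<in> L \<Longrightarrow> scale' c x \<in> L"
      "\<And>x y. x \<in> L \<Longrightarrow> y \<in> L \<Longrightarrow> bracket' x y \<in> L"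
    and hom: "\<And>x y. x \<in> L \<Longrightarrow> y \<in> L \<Longrightarrow> g (x + y) = g x + g y"
      "\<And>c x. x \<in> L \<Longrightarrow> g (scale' c x) = c *s g x"
      "\<And>x y. x \<in> L \<Longrightarrow> y \<in> L \<Longrightarrow> g (bracket' x y) = bracket (g x) (g y)"
  shows "subalgebra (g ` L)" "lie_isomorphic (*s) bracket (g ` L) scale' bracket' L"
proof -
  have "subspace (g ` L)"
  proof (rule subspaceI)
    obtain x where "x \<in> L" using ne by blast
    then have "0 = g (scale' 0 x)" "scale' 0 x \<in> L" using hom(2) closed(2) by simp_all
    then show "0 \<in> g ` L" by blast
  qed (use closed hom in \<open>auto simp: image_iff, metis+\<close>)
  then show "subalgebra (g ` L)"
    unfolding subalgebra_def using closed(3) hom(3) by (auto simp: image_iff) metis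
  let ?f = "the_inv_into L g"
  have f: "?f (g x) = x" if "x \<in> L" for x using the_inv_into_f_f[OF inj that] .
  show "lie_isomorphic (*s) bracket (g ` L) scale' bracket' L"
    unfolding lie_isomorphic_def
  proof (intro exI[of _ ?f] conjI ballI allI)
    show "bij_betw ?f (g ` L) L" using inj by (simp add: bij_betw_the_inv_into inj_on_imp_bij_betw)
  qed (auto simp: f closed simp flip: hom)
qed

section \<open>Solvable algebras with an action of sl2\<close>

locale sl2_triple = char0_lie_algebra smul Basis bracket
  for smul :: "'k::field_char_0 \<Rightarrow> 'v::ab_group_add \<Rightarrow> 'v" (infixr \<open>*s\<close> 75)
    and Basis :: "'v set" and bracket :: "'v \<Rightarrow> 'v \<Rightarrow> 'v" +
  fixes e h f :: 'v
  assumes he: "bracket h e = 2 *s e" and hf: "bracket h f = (-2) *s f" and ef: "bracket e f = h"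
begin

sublocale action: sl2_action smul Basis "bracket e" "bracket f" "bracket h"
proof unfold_locales
  fix x
  show "bracket e (bracket f x) = bracket f (bracket e x) + bracket h x"
    using bracket_derivation[of e f x] by (simp add: ef add.commute)
  show "bracket h (bracket e x) = bracket e (bracket h x) + 2 *s bracket e x"
    using bracket_derivation[of h e x] by (simp add: he bracket_scale_left add.commute)
  show "bracket h (bracket f x) = bracket f (bracket h x) - 2 *s bracket f x"
    using bracket_derivation[of h f x] by (simp add: hf bracket_scale_left bracket_left_simps)
qed (simp_all add: bracket_add_right bracket_scale_right)

definition stable :: "'v set \<Rightarrow> bool" where
  "stable N \<longleftrightarrow> subalgebra N \<and> (\<forall>x\<in>N. bracket e x \<in> N \<and> bracket h x \<in> N \<and> bracket f x \<in> N)"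

definition invariant :: "'v \<Rightarrow> bool" where
  "invariant c \<longleftrightarrow> bracket e c = 0 \<and> bracket h c = 0 \<and> bracket f c = 0"

text \<open>The subalgebra \<open>sl\<^sub>2\<close> is simple, so its action is trivial once \<open>e\<close> acts trivially; concretely,
\<open>h = [e, f]\<close> and \<open>2f = [f, h]\<close>.\<close>

lemma stable_invariant:
  assumes "stable N" "\<And>c. c \<in> N \<Longrightarrow> bracket e c = 0" "c \<in> N"
  shows "invariant c"
proof -
  have h0: "bracket h c = 0" if "c \<in> N" for c
    using action.EF[of c] assms that unfolding stable_def by (simp add: bracket_simps)
  have "bracket f c \<in> N" using assms unfolding stable_def by blast
  then have "bracket f c = 0"
    using action.HF[of c] h0 assms(3) by (simp add: bracket_simps)
  then show ?thesis using h0 assms(2,3) unfolding invariant_def by simp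
qed

lemma ideal_stable: "ideal_of I UNIV \<Longrightarrow> stable I"
  unfolding ideal_of_def stable_def subalgebra_def by blast

lemma stable_derived:
  assumes "stable N"
  shows "bracket_span N N \<subseteq> N" "stable (bracket_span N N)"
proof -
  have N: "subspace N" "\<And>x y. x \<in> N \<Longrightarrow> y \<in> N \<Longrightarrow> bracket x y \<in> N"
    using assms unfolding stable_def subalgebra_def by blast+
  show sub: "bracket_span N N \<subseteq> N"
    unfolding bracket_span_def using N by (intro span_minimal) auto
  have act: "bracket a x \<in> bracket_span N N"
    if a: "\<And>x. x \<in> N \<Longrightarrow> bracket a x \<in> N" and x: "x \<in> bracket_span N N" for a x
  proof -
    show ?thesis
    proof (rule span_induct[OF x[unfolded bracket_span_def], where P = "\<lambda>x. bracket a x \<in> bracket_span N N"])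
      show "subspace {x. bracket a x \<in> bracket_span N N}"
        by (rule pair.linear_subspace_linear_preimage[OF endo_bracket subspace_bracket_span])
      fix y assume "y \<in> {bracket x y |x y. x \<in> N \<and> y \<in> N}"
      then obtain u v where y: "y = bracket u v" and uv: "u \<in> N" "v \<in> N" by blast
      have "bracket (bracket a u) v \<in> bracket_span N N" "bracket u (bracket a v) \<in> bracket_span N N"
        using a uv bracket_span_mem by blast+
      then show "bracket a y \<in> bracket_span N N"
        unfolding y bracket_derivation[of a u v] by (rule subspace_add[OF subspace_bracket_span])
    qed
  qed
  show "stable (bracket_span N N)"
    unfolding stable_def subalgebra_def
    using sub act assms N(2) subspace_bracket_span unfolding stable_def by blast
qed

text \<open>Take \<open>N\<close> of least dimension among the stable subalgebras of \<open>I\<close> with nontrivial action. Its derived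
algebra is again stable and, \<open>N\<close> being solvable, smaller, so the action on it has to be trivial.\<close>

lemma minimal_stable_subalgebra:
  assumes "stable I" "solvable I" "y \<in> I" "bracket e y \<noteq> 0"
  obtains N where "stable N" "N \<subseteq> I" "\<exists>y\<in>N. bracket e y \<noteq> 0"
    "\<And>c. c \<in> bracket_span N N \<Longrightarrow> invariant c"
proof -
  define P where "P N \<longleftrightarrow> stable N \<and> N \<subseteq> I \<and> (\<exists>y\<in>N. bracket e y \<noteq> 0)" for N
  have "P I" using assms unfolding P_def by blast
  from ex_has_least_nat[of P, OF this, of dim]
  obtain N where N: "P N" "\<And>M. P M \<Longrightarrow> dim N \<le> dim M" by blast
  let ?D = "bracket_span N N"
  have st: "stable N" "subspace N" using N(1) unfolding P_def stable_def subalgebra_def by blast+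
  have D: "?D \<subseteq> N" "stable ?D" using stable_derived st(1) by blast+
  have "bracket e c = 0" if c: "c \<in> ?D" for c
  proof (rule ccontr)
    assume "bracket e c \<noteq> 0"
    then have "P ?D" using c D N(1) unfolding P_def by blast
    then have "?D = N"
      using subspace_dim_equal[of ?D N] N(2) D st unfolding stable_def subalgebra_def by blast
    then have "N \<subseteq> {0}" using solvable_not_perfect[OF assms(2), of N] N(1) unfolding P_def by simp
    then show False using N(1) unfolding P_def by (auto simp: bracket_simps)
  qed
  then have "invariant c" if "c \<in> ?D" for c using stable_invariant[OF D(2)] that by blast
  then show ?thesis using that N(1) unfolding P_def by blast
qed

text \<open>Applying \<open>ad e\<close> at most twice to a nonzero element of the intersection produces a nonzero multiple
of \<open>e\<close>; then the ideal contains the whole triple, which lies in its own derived span.\<close>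

lemma sl2_meets_solvable_ideal_trivially:
  assumes I: "ideal_of I UNIV" "solvable I" and e: "e \<noteq> 0"
    and mem: "a *s h + b *s e + c *s f \<in> I"
  shows "a = 0" "b = 0" "c = 0"
proof -
  have sub: "subspace I" and absorb: "\<And>x y. y \<in> I \<Longrightarrow> bracket x y \<in> I"
    using I(1) unfolding ideal_of_def by blast+
  have scaleD: "x \<in> I" if "r *s x \<in> I" "r \<noteq> 0" for r x
    using subspace_scale[OF sub that(1), of "inverse r"] that(2) by simp
  have eh: "bracket e h = (-2) *s e" using bracket_commute[of e h] he by simp
  have eI: "e \<notin> I"
  proof
    assume eI: "e \<in> I"
    have "bracket f e = - h" using bracket_commute[of f e] ef by simp
    then have hI: "h \<in> I" using absorb[OF eI, of f] subspace_neg[OF sub] by fastforce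
    have "bracket f h = 2 *s f" using bracket_commute[of f h] hf by simp
    then have fI: "f \<in> I" using absorb[OF hI, of f] scaleD[of 2 f] by simp
    let ?N = "{e, h, f}"
    have D: "bracket h e \<in> bracket_span ?N ?N" "bracket h f \<in> bracket_span ?N ?N"
      "bracket e f \<in> bracket_span ?N ?N" by (rule bracket_span_mem; simp)+
    have sp: "x \<in> bracket_span ?N ?N" if "r *s x \<in> bracket_span ?N ?N" "r \<noteq> 0" for r x
      using span_scale[OF that(1)[unfolded bracket_span_def], of "inverse r"] that(2)
      unfolding bracket_span_def by simp
    have "?N \<subseteq> bracket_span ?N ?N"
      using D sp[of 2 e] sp[of "-2" f] unfolding he hf ef by simp
    then have "?N \<subseteq> {0}" using solvable_not_perfect[OF I(2), of ?N] eI hI fI by simp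
    then show False using e by simp
  qed
  have 1: "bracket e (a *s h + b *s e + c *s f) = (- 2 * a) *s e + c *s h"
    by (simp add: bracket_simps eh ef bracket_self mult.commute)
  have "bracket e (bracket e (a *s h + b *s e + c *s f)) = (- 2 * c) *s e"
    unfolding 1 by (simp add: bracket_simps eh bracket_self mult.commute)
  then have "(- 2 * c) *s e \<in> I" using absorb[OF absorb[OF mem], of e e] by simp
  then show c: "c = 0" using eI scaleD[of "-2 * c" e] by fastforce
  have "(- 2 * a) *s e \<in> I" using absorb[OF mem, of e] unfolding 1 unfolding c by simp
  then show a: "a = 0" using eI scaleD[of "-2 * a" e] by fastforce
  show "b = 0" using mem eI scaleD[of b e] unfolding a c by fastforce
qed

end

section \<open>The subalgebra generated by a string\<close>

lemma sl2_diff: "A \<in> sl2 \<Longrightarrow> B \<in> sl2 \<Longrightarrow> A - B \<in> sl2"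
  by (simp add: sl2_def trace_def sum_subtractf)

context sl2_triple begin

text \<open>Apply an element \<open>a\<close> of the triple to \<open>[x, c] \<in> [N, N]\<close>: both \<open>[a, [x, c]]\<close> and \<open>[a, c]\<close> are zero, and so is the
remaining term \<open>[[a, x], c]\<close> of the Jacobi identity.\<close>

lemma derived_commutes_with_action:
  assumes "stable N" "\<And>c. c \<in> bracket_span N N \<Longrightarrow> invariant c"
    and x: "x \<in> N" and c: "c \<in> bracket_span N N"
  shows "bracket (bracket e x) c = 0" "bracket (bracket h x) c = 0" "bracket (bracket f x) c = 0"
proof -
  have "c \<in> N" using c stable_derived(1)[OF assms(1)] by blast
  then have "invariant (bracket x c)" "invariant c"
    using assms(2) c x bracket_span_mem by blast+
  then show "bracket (bracket e x) c = 0" "bracket (bracket h x) c = 0" "bracket (bracket f x) c = 0"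
    using bracket_derivation[of _ x c] unfolding invariant_def by (metis add.right_neutral bracket_simps(1))+
qed

end

text \<open>A highest weight vector together with what the minimality of the surrounding solvable algebra
provides: the brackets of the string are invariant and commute with the string.\<close>

locale sl2_string = sl2_triple smul Basis bracket e h f
  for smul :: "'k::field_char_0 \<Rightarrow> 'v::ab_group_add \<Rightarrow> 'v" (infixr \<open>*s\<close> 75)
    and Basis :: "'v set" and bracket :: "'v \<Rightarrow> 'v \<Rightarrow> 'v" and e h f :: 'v +
  fixes v :: 'v and d :: nat
  assumes v: "v \<noteq> 0" "bracket e v = 0" "bracket h v = of_nat d *s v" and d: "d \<ge> 1"
    and invariant_brackets: "invariant (bracket ((bracket f ^^ i) v) ((bracket f ^^ j) v))"
    and central_brackets:
      "bracket ((bracket f ^^ l) v) (bracket ((bracket f ^^ i) v) ((bracket f ^^ j) v)) = 0"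
begin

definition w :: "nat \<Rightarrow> 'v" where
  "w i = (bracket f ^^ i) v"

lemma f_w: "bracket f (w i) = w (Suc i)"
  by (simp add: w_def)

lemma h_w: "bracket h (w i) = (of_nat d - 2 * of_nat i) *s w i"
  unfolding w_def action.H_F_power v(3) by (simp add: action.Fpow_simps scale_left_diff_distrib)

lemma e_w: "bracket e (w (Suc i)) = (of_nat (Suc i) * (of_nat d - of_nat i)) *s w i"
  unfolding w_def by (rule action.E_F_power_weight[OF v(2,3)])

lemma w_top: "w (Suc d) = 0" and w_nonzero: "i \<le> d \<Longrightarrow> w i \<noteq> 0"
  using action.highest_weight_string[OF v] unfolding w_def by blast+

definition string_vec :: "(nat \<Rightarrow> 'k) \<Rightarrow> 'v" where
  "string_vec x = (\<Sum>i\<le>d. x i *s w i)"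

definition sl2_vec :: "'k ^ 2 ^ 2 \<Rightarrow> 'v" where
  "sl2_vec A = A $ 1 $ 1 *s h + A $ 1 $ 2 *s e + A $ 2 $ 1 *s f"

lemma string_vec_add: "string_vec (x + y) = string_vec x + string_vec y"
  by (simp add: string_vec_def scale_left_distrib sum.distrib)

lemma string_vec_scale: "string_vec (coord_scale c x) = c *s string_vec x"
  by (simp add: string_vec_def coord_scale_def scale_sum_right)

lemma string_vec_diff: "string_vec (x - y) = string_vec x - string_vec y"
  by (simp add: string_vec_def scale_left_diff_distrib sum_subtractf)

lemma bracket_string_vec: "bracket a (string_vec x) = (\<Sum>i\<le>d. x i *s bracket a (w i))"
  by (simp add: string_vec_def pair.linear_sum[OF endo_bracket] bracket_simps)

lemma h_string_vec: "bracket h (string_vec x) = string_vec (string_H d x)"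
  unfolding bracket_string_vec by (simp add: string_vec_def string_H_def h_w mult.commute)

lemma e_string_vec: "bracket e (string_vec x) = string_vec (string_E d x)"
proof -
  obtain k where k: "d = Suc k" using d by (cases d) auto
  have "bracket e (string_vec x) = (\<Sum>i\<le>k. x (Suc i) *s bracket e (w (Suc i)))"
    unfolding bracket_string_vec using v(2) by (simp add: k sum.atMost_Suc_shift w_def del: sum.atMost_Suc)
  also have "\<dots> = (\<Sum>i\<le>k. string_E d x i *s w i)"
    unfolding e_w by (rule sum.cong) (auto simp: string_E_def k mult.commute)
  also have "\<dots> = string_vec (string_E d x)"
    unfolding string_vec_def by (simp add: k string_E_def)
  finally show ?thesis .
qed

lemma f_string_vec: "bracket f (string_vec x) = string_vec (string_F d x)"
proof -
  obtain k where k: "d = Suc k" using d by (cases d) auto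
  have "string_vec (string_F d x) = (\<Sum>i\<le>k. string_F d x (Suc i) *s w (Suc i))"
    unfolding string_vec_def by (simp add: k sum.atMost_Suc_shift string_F_def del: sum.atMost_Suc)
  also have "\<dots> = (\<Sum>i\<le>k. x i *s w (Suc i))"
    by (rule sum.cong) (auto simp: string_F_def k)
  also have "\<dots> = bracket f (string_vec x)"
    unfolding bracket_string_vec using w_top by (simp add: f_w k)
  finally show ?thesis by simp
qed

lemma sl2_vec_string_vec: "bracket (sl2_vec A) (string_vec x) = string_vec (string_act d A x)"
  by (simp add: sl2_vec_def string_act_def bracket_add_left bracket_scale_left h_string_vec e_string_vec f_string_vec
      string_vec_add string_vec_scale)

lemma sl2_vec_add: "sl2_vec (A + B) = sl2_vec A + sl2_vec B"
  by (simp add: sl2_vec_def scale_left_distrib)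

lemma sl2_vec_diff: "sl2_vec (A - B) = sl2_vec A - sl2_vec B"
  by (simp add: sl2_vec_def scale_left_diff_distrib)

lemma sl2_vec_scale: "sl2_vec (sl2_scale c A) = c *s sl2_vec A"
  by (simp add: sl2_vec_def sl2_scale_entry scale_right_distrib)

lemma sl2_vec_bracket:
  assumes "A \<in> sl2" "B \<in> sl2"
  shows "sl2_vec (sl2_bracket A B) = bracket (sl2_vec A) (sl2_vec B)"
proof -
  have "bracket e h = (-2) *s e" using bracket_commute[of e h] he by simp
  moreover have "bracket f h = 2 *s f" using bracket_commute[of f h] hf by simp
  moreover have "bracket f e = (-1) *s h" using bracket_commute[of f e] ef by simp
  ultimately have "bracket (sl2_vec A) (sl2_vec B)
    = (A $ 1 $ 2 * B $ 2 $ 1 - B $ 1 $ 2 * A $ 2 $ 1) *s h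
      + (2 * (A $ 1 $ 1 * B $ 1 $ 2 - B $ 1 $ 1 * A $ 1 $ 2)) *s e
      + (2 * (B $ 1 $ 1 * A $ 2 $ 1 - A $ 1 $ 1 * B $ 2 $ 1)) *s f"
    by (simp add: sl2_vec_def bracket_add_left bracket_add_right bracket_scale_left bracket_scale_right
        he hf ef bracket_self algebra_simps)
  then show ?thesis by (simp add: sl2_vec_def sl2_bracket_entries[OF assms])
qed

definition c0 :: 'v where
  "c0 = bracket (w 0) (w d)"

text \<open>Invariance of the brackets under \<open>h\<close> kills those of nonzero weight, and invariance under \<open>f\<close> gives
\<open>[w\<^sub>i\<^sub>+\<^sub>1, w\<^sub>j] = - [w\<^sub>i, w\<^sub>j\<^sub>+\<^sub>1]\<close>.\<close>

lemma bracket_w_w: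
  assumes "i \<le> d" "j \<le> d"
  shows "bracket (w i) (w j) = (if i + j = d then (-1) ^ i *s c0 else 0)"
proof -
  have inv: "invariant (bracket (w i) (w j))" for i j
    unfolding w_def by (rule invariant_brackets)
  show ?thesis
  proof (cases "i + j = d")
    case True
    have "bracket (w i) (w (d - i)) = (-1) ^ i *s c0" if "i \<le> d" for i
      using that
    proof (induction i)
      case (Suc i)
      have "bracket f (bracket (w i) (w (d - Suc i))) = 0" using inv unfolding invariant_def by blast
      then have "bracket (w (Suc i)) (w (d - Suc i)) + bracket (w i) (w (Suc (d - Suc i))) = 0"
        using bracket_derivation[of f] by (simp add: f_w)
      moreover have "Suc (d - Suc i) = d - i" using Suc.prems by simp
      ultimately show ?case using Suc by (simp add: eq_neg_iff_add_eq_0)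
    qed (simp add: c0_def)
    from this[OF assms(1)] True show ?thesis by auto
  next
    case False
    have "0 = bracket h (bracket (w i) (w j))" using inv unfolding invariant_def by metis
    also have "\<dots> = (2 * (of_nat d - of_nat (i + j))) *s bracket (w i) (w j)"
      unfolding bracket_derivation[of h] h_w
      by (simp add: bracket_scale_left bracket_scale_right flip: scale_left_distrib)
    finally show ?thesis using False by (auto simp flip: of_nat_add)
  qed
qed

text \<open>The invariant bilinear form on the module of highest weight \<open>d\<close>, unique up to a scalar. It is alternating
if \<open>d\<close> is odd and symmetric if \<open>d\<close> is even.\<close>

definition string_form :: "(nat \<Rightarrow> 'k) \<Rightarrow> (nat \<Rightarrow> 'k) \<Rightarrow> 'k" where
  "string_form x y = (\<Sum>i\<le>d. (-1) ^ i * x i * y (d - i))"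

lemma string_vec_bracket: "bracket (string_vec x) (string_vec y) = string_form x y *s c0"
proof -
  have "bracket (string_vec x) (string_vec y) = (\<Sum>i\<le>d. x i *s bracket (w i) (string_vec y))"
    unfolding string_vec_def[of x]
    by (simp add: pair.linear_sum[OF endo_bracket_left] bracket_scale_left)
  also have "\<dots> = (\<Sum>i\<le>d. ((-1) ^ i * x i * y (d - i)) *s c0)"
  proof (rule sum.cong[OF refl])
    fix i assume i: "i \<in> {..d}"
    have "bracket (w i) (string_vec y) = (\<Sum>j\<le>d. if j = d - i then ((-1) ^ i * y (d - i)) *s c0 else 0)"
      unfolding bracket_string_vec using i by (intro sum.cong refl) (auto simp: bracket_w_w mult.commute)
    then show "x i *s bracket (w i) (string_vec y) = ((-1) ^ i * x i * y (d - i)) *s c0"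
      by (simp add: ac_simps)
  qed
  also have "\<dots> = string_form x y *s c0" by (simp add: string_form_def scale_sum_left)
  finally show ?thesis .
qed

lemma c0_invariant: "invariant c0"
  unfolding c0_def w_def by (rule invariant_brackets)

lemma sl2_vec_c0: "bracket (sl2_vec A) c0 = 0"
  using c0_invariant unfolding invariant_def sl2_vec_def by (simp add: bracket_add_left bracket_scale_left)

lemma string_vec_c0: "bracket (string_vec x) c0 = 0"
proof -
  have "bracket c0 (w i) = 0" for i
    using central_brackets[of i 0 d] bracket_commute[of c0 "w i"] by (simp add: c0_def w_def)
  then have "bracket c0 (string_vec x) = 0" by (simp add: bracket_string_vec)
  then show ?thesis using bracket_commute[of "string_vec x" c0] by simp
qed

text \<open>Applying \<open>e\<close> repeatedly to a nonzero vector of the string leads to a multiple of \<open>w 0\<close>, which \<open>f\<close> does not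
kill; an invariant vector cannot behave in this way.\<close>

lemma string_vec_invariant_independent:
  assumes "x \<in> coord_space (Suc d)" "string_vec x = c" "invariant c"
  shows "x = 0"
proof (rule ccontr)
  assume "x \<noteq> 0"
  have no: False if "x k \<noteq> 0" "\<And>i. i > k \<Longrightarrow> x i = 0" "k \<le> d" "invariant (string_vec x)" for x k
    using that
  proof (induction k arbitrary: x)
    case 0
    have "(\<Sum>i\<in>{..d} - {0}. x i *s w i) = 0" by (rule sum.neutral) (simp add: 0(2))
    then have "string_vec x = x 0 *s w 0" unfolding string_vec_def by (subst sum.remove[of _ 0]) auto
    then have "x 0 *s w 1 = 0" using 0(4) f_w[of 0] unfolding invariant_def by (simp add: bracket_simps)
    then show False using 0(1) w_nonzero[of 1] d by simp
  next
    case (Suc k)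
    have "string_E d x k \<noteq> 0" "\<And>i. i > k \<Longrightarrow> string_E d x i = 0"
      using string_E_top[of x k d] Suc.prems(1-3) by auto
    moreover have "string_vec (string_E d x) = 0"
      using Suc.prems(4) unfolding invariant_def by (simp add: e_string_vec)
    then have "invariant (string_vec (string_E d x))" by (simp add: invariant_def bracket_simps)
    ultimately show False using Suc.IH[of "string_E d x"] Suc.prems(3) by simp
  qed
  from coord_space_top[OF assms(1) \<open>x \<noteq> 0\<close>] obtain k
    where "x k \<noteq> 0" "k \<le> d" "\<And>i. i > k \<Longrightarrow> x i = 0" by blast
  then show False using no[of x k] assms(2,3) by blast
qed

text \<open>The string and \<open>c0\<close> lie in \<open>I\<close>, which meets the triple trivially, so the \<open>sl\<^sub>2\<close> component vanishes first.\<close>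

lemma embedding_injective:
  assumes I: "ideal_of I UNIV" "solvable I" "v \<in> I" and z: "A \<in> sl2" "x \<in> coord_space (Suc d)"
    and eq: "sl2_vec A + string_vec x + a *s c0 = 0"
  shows "A = 0" "x = 0" "a *s c0 = 0"
proof -
  have sub: "subspace I" and absorb: "\<And>x y. y \<in> I \<Longrightarrow> bracket x y \<in> I"
    using I(1) unfolding ideal_of_def by blast+
  have w: "w i \<in> I" for i by (induction i) (use I(3) absorb in \<open>auto simp: w_def\<close>)
  have "string_vec x + a *s c0 \<in> I"
    unfolding string_vec_def c0_def using w absorb sub by (intro subspace_add subspace_sum subspace_scale) auto
  moreover have "sl2_vec A = - (string_vec x + a *s c0)" using eq by (simp only: eq_neg_iff_add_eq_0 add.assoc)
  ultimately have "sl2_vec A \<in> I" using subspace_neg[OF sub] by metis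
  moreover have "e \<noteq> 0"
  proof
    assume "e = 0"
    then have "h = 0" using ef by (simp add: bracket_left_simps)
    then show False using v d by (simp add: bracket_left_simps)
  qed
  ultimately show A: "A = 0"
    using sl2_meets_solvable_ideal_trivially[OF I(1,2)] z(1)
    unfolding sl2_vec_def by (intro sl2_eqI) (auto simp: sl2_def trace_def)
  then have "string_vec x = (- a) *s c0" using eq by (simp add: sl2_vec_def eq_neg_iff_add_eq_0)
  moreover have "invariant ((- a) *s c0)"
    using c0_invariant unfolding invariant_def by (simp only: bracket_scale_right scale_zero_right)
  ultimately show x: "x = 0" by (rule string_vec_invariant_independent[OF z(2)])
  show "a *s c0 = 0" using eq unfolding A x by (simp add: sl2_vec_def string_vec_def)
qed

lemma iso_abelian:
  assumes I: "ideal_of I UNIV" "solvable I" "v \<in> I" and c0: "c0 = 0"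
  shows "\<exists>L. subalgebra L \<and> iso_sl2_v smul bracket L (Suc d)"
proof -
  define g where "g = (\<lambda>(A, x). sl2_vec A + string_vec x)"
  let ?L = "sl2 \<times> coord_space (Suc d) :: (('k ^ 2 ^ 2) \<times> (nat \<Rightarrow> 'k)) set"
  let ?b = "semidirect_bracket sl2_bracket (\<lambda>x y. 0) (string_act d)"
  have inj: "inj_on g ?L"
  proof (rule inj_onI, clarify)
    fix A B x y assume AB: "A \<in> sl2" "B \<in> sl2" "x \<in> coord_space (Suc d)" "y \<in> coord_space (Suc d)"
      and eq: "g (A, x) = g (B, y)"
    have "sl2_vec (A - B) + string_vec (x - y) + 0 *s c0 = 0"
      using eq by (simp add: g_def sl2_vec_diff string_vec_diff algebra_simps)
    from embedding_injective[OF I sl2_diff[OF AB(1,2)] coord_space_closed(3)[OF AB(3,4)] this]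
    show "A = B \<and> x = y" by simp
  qed
  have zero: "(0, 0) \<in> ?L" by (simp add: sl2_def trace_def coord_space_closed)
  have nonempty: "?L \<noteq> {}" using zero by blast
  have closed: "\<And>x y. x \<in> ?L \<Longrightarrow> y \<in> ?L \<Longrightarrow> x + y \<in> ?L"
      "\<And>c x. x \<in> ?L \<Longrightarrow> pair_scale sl2_scale coord_scale c x \<in> ?L"
      "\<And>x y. x \<in> ?L \<Longrightarrow> y \<in> ?L \<Longrightarrow> ?b x y \<in> ?L"
    by (auto simp: pair_scale_def semidirect_bracket_def sl2_closed coord_space_closed string_closed)
  have linear: "g (x + y) = g x + g y" "g (pair_scale sl2_scale coord_scale c x) = c *s g x" for c x y
    by (auto simp: g_def sl2_vec_add string_vec_add sl2_vec_scale string_vec_scale pair_scale_def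
        scale_right_distrib scale_left_distrib split: prod.splits)
  have hom: "g (?b x y) = bracket (g x) (g y)" if "x \<in> ?L" "y \<in> ?L" for x y
    using that c0
    by (auto simp: g_def semidirect_bracket_def sl2_vec_bracket string_vec_add string_vec_diff
        bracket_add_left bracket_add_right bracket_scale_left bracket_scale_right bracket_self
        sl2_vec_string_vec string_vec_bracket sl2_vec_c0 string_vec_c0
        bracket_commute[of "string_vec _" "sl2_vec _"] bracket_commute[of c0])
  have sub: "subalgebra (g ` ?L)" "lie_isomorphic smul bracket (g ` ?L) (pair_scale sl2_scale coord_scale) ?b ?L"
    by (rule subalgebra_isomorphic_image[where g = g and L = ?L and scale' = "pair_scale sl2_scale coord_scale" and bracket' = ?b];
        (fact inj nonempty closed hom | simp only: linear))+
  then show ?thesis unfolding iso_sl2_v_def using is_v_string[of d] by blast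
qed

text \<open>If \<open>d\<close> were even, \<open>c0 = [w 0, w d] = - [w d, w 0] = - c0\<close>. The properties of the form are read off from those
of the bracket, as \<open>c0 \<noteq> 0\<close> may be cancelled.\<close>

lemma iso_heisenberg:
  assumes I: "ideal_of I UNIV" "solvable I" "v \<in> I" and c0: "c0 \<noteq> 0"
  shows "\<exists>L m. subalgebra L \<and> Suc d = 2 * m \<and> iso_sl2_heisenberg smul bracket L m"
proof -
  have "odd d"
  proof (rule ccontr)
    assume "\<not> odd d"
    then have "bracket (w d) (w 0) = c0" using bracket_w_w[of d 0] by simp
    then have "c0 = - c0" using bracket_commute[of "w d" "w 0"] by (simp only: c0_def)
    then have "c0 + c0 = 0" by (simp only: eq_neg_iff_add_eq_0)
    then have "2 *s c0 = 0" using scale_left_distrib[of 1 1 c0] by simp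
    then show False using c0 by simp
  qed
  then obtain m where m: "Suc d = 2 * m" by (metis dvdE even_Suc)
  have cancel: "r = 0" if "r *s c0 = 0" for r using that c0 by simp
  define g where "g = (\<lambda>(A, x, a). sl2_vec A + (string_vec x + a *s c0))"
  let ?L = "sl2 \<times> (coord_space (Suc d) \<times> UNIV) :: (('k ^ 2 ^ 2) \<times> (nat \<Rightarrow> 'k) \<times> 'k) set"
  let ?b = "semidirect_bracket sl2_bracket (\<lambda>(x, a) (y, b). (0, string_form x y)) (\<lambda>A (x, a). (string_act d A x, 0))"
  have inj: "inj_on g ?L"
  proof (rule inj_onI)
    fix p q assume pq: "p \<in> ?L" "q \<in> ?L" "g p = g q"
    obtain A x a B y b where p: "p = (A, x, a)" and q: "q = (B, y, b)" by (metis prod_cases3)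
    have AB: "A \<in> sl2" "B \<in> sl2" "x \<in> coord_space (Suc d)" "y \<in> coord_space (Suc d)"
      and eq: "g (A, x, a) = g (B, y, b)"
      using pq unfolding p q by simp_all
    have "sl2_vec (A - B) + string_vec (x - y) + (a - b) *s c0 = 0"
      using eq by (simp add: g_def sl2_vec_diff string_vec_diff algebra_simps)
    from embedding_injective[OF I sl2_diff[OF AB(1,2)] coord_space_closed(3)[OF AB(3,4)] this]
    show "p = q" using c0 unfolding p q by simp
  qed
  have zero: "(0, 0, 0) \<in> ?L" by (simp add: sl2_def trace_def coord_space_closed)
  have nonempty: "?L \<noteq> {}" using zero by blast
  have closed: "\<And>x y. x \<in> ?L \<Longrightarrow> y \<in> ?L \<Longrightarrow> x + y \<in> ?L"
      "\<And>c x. x \<in> ?L \<Longrightarrow> pair_scale sl2_scale (pair_scale coord_scale (*)) c x \<in> ?L"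
      "\<And>x y. x \<in> ?L \<Longrightarrow> y \<in> ?L \<Longrightarrow> ?b x y \<in> ?L"
    by (auto simp: pair_scale_def semidirect_bracket_def sl2_closed coord_space_closed string_closed)
  have linear: "g (x + y) = g x + g y" "g (pair_scale sl2_scale (pair_scale coord_scale (*)) c x) = c *s g x" for c x y
    by (auto simp: g_def sl2_vec_add string_vec_add sl2_vec_scale string_vec_scale pair_scale_def
        scale_right_distrib scale_left_distrib split: prod.splits)
  have hom: "g (?b x y) = bracket (g x) (g y)" if "x \<in> ?L" "y \<in> ?L" for x y
    using that
    by (auto simp: g_def semidirect_bracket_def sl2_vec_bracket string_vec_add string_vec_diff
        bracket_add_left bracket_add_right bracket_scale_left bracket_scale_right bracket_self
        sl2_vec_string_vec string_vec_bracket sl2_vec_c0 string_vec_c0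
        bracket_commute[of "string_vec _" "sl2_vec _"] bracket_commute[of c0])
  have sub: "subalgebra (g ` ?L)" "lie_isomorphic smul bracket (g ` ?L) (pair_scale sl2_scale (pair_scale coord_scale (*))) ?b ?L"
    by (rule subalgebra_isomorphic_image[where g = g and L = ?L and scale' = "pair_scale sl2_scale (pair_scale coord_scale (*))" and bracket' = ?b];
        (fact inj nonempty closed hom | simp only: linear))+
  have "string_form x x = 0" for x using string_vec_bracket[of x x] by (intro cancel) (simp add: bracket_self)
  moreover have "string_form (string_act d A x) y + string_form x (string_act d A y) = 0" for A x y
  proof (rule cancel)
    have "(string_form (string_act d A x) y + string_form x (string_act d A y)) *s c0
        = bracket (sl2_vec A) (bracket (string_vec x) (string_vec y))"
      by (simp add: scale_left_distrib sl2_vec_string_vec bracket_derivation[of "sl2_vec A"] flip: string_vec_bracket)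
    also have "\<dots> = 0" by (simp add: string_vec_bracket bracket_scale_right sl2_vec_c0)
    finally show "(string_form (string_act d A x) y + string_form x (string_act d A y)) *s c0 = 0" .
  qed
  ultimately have "invariant_alternating_form (Suc d) (string_act d) string_form"
    unfolding invariant_alternating_form_def
    by (auto simp: string_form_def coord_scale_def sum.distrib sum_distrib_left algebra_simps)
  moreover have "string_form (unit_coord 0) (unit_coord d) \<noteq> 0"
  proof -
    have "string_form (unit_coord 0) (unit_coord d) = (\<Sum>i\<le>d. if i = 0 then 1 else 0)"
      unfolding string_form_def by (rule sum.cong) (auto simp: unit_coord_def)
    then show ?thesis by simp
  qed
  moreover have "unit_coord 0 \<in> coord_space (Suc d)" "unit_coord d \<in> coord_space (Suc d)"
    by (auto simp: unit_coord_def coord_space_def)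
  ultimately have "iso_sl2_heisenberg smul bracket (g ` ?L) m"
    unfolding iso_sl2_heisenberg_def m[symmetric] using is_v_string[of d] sub by blast
  then show ?thesis using sub m by blast
qed

end

section \<open>Isotropic simple factors acting on solvable ideals\<close>

context sl2_triple begin

text \<open>The string through a highest weight vector of a minimal \<open>N\<close> generates the required subalgebra; which of the
two shapes occurs depends on whether \<open>c0\<close> vanishes.\<close>

lemma subalgebra_of_nontrivial_action:
  assumes I: "ideal_of I UNIV" "solvable I" and y: "y \<in> I" "bracket e y \<noteq> 0"
  shows "\<exists>L n. subalgebra L \<and> n \<ge> 2 \<and>
    (iso_sl2_v smul bracket L n \<or> iso_sl2_heisenberg smul bracket L (n - 1))"
proof -
  obtain N where N: "stable N" "N \<subseteq> I" "\<exists>y\<in>N. bracket e y \<noteq> 0"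
    "\<And>c. c \<in> bracket_span N N \<Longrightarrow> invariant c"
    using minimal_stable_subalgebra[OF ideal_stable[OF I(1)] I(2) y] by metis
  obtain y' where y': "y' \<in> N" "bracket e y' \<noteq> 0" using N(3) by blast
  have st: "subspace N" "\<And>x. x \<in> N \<Longrightarrow> bracket e x \<in> N" "\<And>x. x \<in> N \<Longrightarrow> bracket h x \<in> N"
    "\<And>x. x \<in> N \<Longrightarrow> bracket f x \<in> N"
    using N(1) unfolding stable_def subalgebra_def by blast+
  obtain v d where vN: "v \<in> N" and d: "d \<ge> 1"
    and v: "v \<noteq> 0" "bracket e v = 0" "bracket h v = of_nat d *s v"
    using action.highest_weight_vector_exists[OF st y'] by blast
  let ?w = "\<lambda>i. (bracket f ^^ i) v"
  have wN: "?w i \<in> N" for i by (induction i) (simp_all add: vN st(4))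
  have mem: "bracket (?w i) (?w j) \<in> bracket_span N N" for i j using wN bracket_span_mem by blast
  have central: "bracket (?w l) (bracket (?w i) (?w j)) = 0" for l i j
  proof (cases l)
    case 0
    have "bracket (bracket h v) (bracket (?w i) (?w j)) = 0"
      by (rule derived_commutes_with_action(2)[OF N(1,4) vN mem])
    then show ?thesis using 0 v(3) d by (simp add: bracket_scale_left)
  next
    case (Suc k)
    have "bracket (bracket f (?w k)) (bracket (?w i) (?w j)) = 0"
      by (rule derived_commutes_with_action(3)[OF N(1,4) wN mem])
    then show ?thesis using Suc by simp
  qed
  interpret string: sl2_string smul Basis bracket e h f v d
    by unfold_locales (use v d central N(4) mem in auto)
  have vI: "v \<in> I" using vN N(2) by blast
  show ?thesis
  proof (cases "string.c0 = 0")
    case True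
    then show ?thesis using string.iso_abelian[OF I vI] d by (metis Suc_le_mono numeral_2_eq_2 One_nat_def)
  next
    case False
    then obtain L m where L: "subalgebra L" "Suc d = 2 * m" "iso_sl2_heisenberg smul bracket L m"
      using string.iso_heisenberg[OF I vI] by blast
    have "m \<ge> 1" using L(2) by simp
    then show ?thesis using L(1,3) by (intro exI[of _ L] exI[of _ "Suc m"]) auto
  qed
qed

end

context char0_lie_algebra begin

text \<open>The centralizer of \<open>I\<close> in \<open>S\<close> is an ideal of \<open>S\<close>, and it is not all of \<open>S\<close>.\<close>

lemma simple_centralizer:
  assumes "simple S" and I: "\<And>x y. x \<in> S \<Longrightarrow> y \<in> I \<Longrightarrow> bracket x y \<in> I"
    and ne: "x \<in> S" "y \<in> I" "bracket x y \<noteq> 0"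
    and z: "z \<in> S" "\<And>y. y \<in> I \<Longrightarrow> bracket z y = 0"
  shows "z = 0"
proof -
  have S: "subalgebra S" "subspace S" using assms(1) unfolding simple_def subalgebra_def by blast+
  define Z where "Z = {z \<in> S. \<forall>y\<in>I. bracket z y = 0}"
  have "ideal_of Z S"
    unfolding ideal_of_def
  proof (intro conjI ballI)
    show "subspace Z" unfolding Z_def using S(2)
      by (intro subspaceI) (auto simp: subspace_0 subspace_add subspace_scale bracket_left_simps
          bracket_add_left bracket_scale_left)
    show "Z \<subseteq> S" unfolding Z_def by blast
    fix u z assume u: "u \<in> S" and z: "z \<in> Z"
    have "bracket (bracket u z) y = 0" if "y \<in> I" for y
      using bracket_derivation[of u z y] z I[OF u that] that by (simp add: Z_def bracket_simps)
    then show "bracket u z \<in> Z" using u z S(1) by (simp add: Z_def subalgebra_mem)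
  qed
  then have "Z = {0} \<or> Z = S" using assms(1) unfolding simple_def by blast
  then show ?thesis using ne z unfolding Z_def by blast
qed

text \<open>Positive rank provides a nonzero torus element. If all its eigenvalues were zero it would be central
in \<open>S\<close>, against simplicity.\<close>

lemma isotropic_split_element:
  assumes simple: "simple S" and iso: "isotropic S"
  obtains h B c b where "h \<in> S" "independent B" "span B = S" "\<And>b. b \<in> B \<Longrightarrow> bracket h b = c b *s b"
    "b \<in> B" "c b \<noteq> 0"
proof -
  have S: "subalgebra S" "subspace S" using simple unfolding simple_def subalgebra_def by blast+
  let ?K = "{dim T | T. split_torus T S}"
  have "?K \<subseteq> {..dimension}" using dim_subset_UNIV by auto
  then have fin: "finite ?K" using finite_subset by blast
  obtain B0 where B0: "independent B0" "span B0 = S" using subspace_basis[OF S(2)] by metis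
  \<comment> \<open>Without this witness the maximum in the definition of the rank would be taken over a possibly empty set.\<close>
  have "split_torus {0} S"
    unfolding split_torus_def
  proof (intro conjI)
    show "subalgebra {0}" by (simp add: subalgebra_def bracket_self)
    show "abelian {0}" by (simp add: abelian_def bracket_self)
    show "{0} \<subseteq> S" using subspace_0[OF S(2)] by simp
    have "bracket 0 b = 0 *s b" for b by (simp add: bracket_left_simps)
    then show "\<exists>B. independent B \<and> span B = S \<and> (\<forall>t\<in>{0}. \<forall>b\<in>B. \<exists>c. bracket t b = c *s b)"
      using B0 by blast
  qed
  then have "?K \<noteq> {}" by blast
  then have "Max ?K \<in> ?K" by (rule Max_in[OF fin])
  then obtain T where T: "split_torus T S" "dim T \<ge> 1"
    using iso unfolding isotropic_def k_rank_def by auto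
  have "T \<noteq> {0}" using T(2) by auto
  moreover have "0 \<in> T" using T(1) unfolding split_torus_def subalgebra_def by (auto intro: subspace_0)
  ultimately obtain h where h: "h \<in> T" "h \<noteq> 0" by blast
  then have hS: "h \<in> S" using T(1) unfolding split_torus_def by blast
  obtain B where B: "independent B" "span B = S" "\<And>b. b \<in> B \<Longrightarrow> \<exists>c. bracket h b = c *s b"
    using T(1) h(1) unfolding split_torus_def by blast
  obtain c where c: "\<And>b. b \<in> B \<Longrightarrow> bracket h b = c b *s b" using B(3) by metis
  have "\<exists>b\<in>B. c b \<noteq> 0"
  proof (rule ccontr)
    assume "\<not> ?thesis"
    then have "bracket h b = 0" if "b \<in> B" for b using c that by simp
    then have 0: "bracket h y = 0" if "y \<in> S" for y
      using pair.linear_eq_0_on_span[OF endo_bracket, of B h y] that B(2) by blast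
    obtain x y where "x \<in> S" "y \<in> S" "bracket x y \<noteq> 0"
      using simple unfolding simple_def abelian_def by blast
    then show False
      using simple_centralizer[OF simple subalgebra_mem[OF S(1)] _ _ _ hS 0] h(2) by blast
  qed
  then show ?thesis using that hS B(1,2) c by blast
qed

lemma sl2_triple_of_isotropic:
  assumes simple: "simple S" and iso: "isotropic S"
  obtains e h f where "e \<in> S" "e \<noteq> 0" "sl2_triple smul Basis bracket e h f"
proof -
  have S: "subalgebra S" using simple unfolding simple_def by blast
  obtain h0 B c e where h0: "h0 \<in> S" and B: "independent B" "span B = S"
    and c: "\<And>b. b \<in> B \<Longrightarrow> bracket h0 b = c b *s b" and e: "e \<in> B" "c e \<noteq> 0"
    using isotropic_split_element[OF simple iso] by metis
  have eS: "e \<in> S" using e(1) B(2) span_base by blast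
  have e0: "e \<noteq> 0" using e(1) B(1) dependent_zero by blast
  have "bracket h0 (bracket e x) = bracket e (bracket h0 x) + c e *s bracket e x" for x
    using bracket_derivation[of h0 e x] c[OF e(1)] by (simp add: bracket_scale_left add.commute)
  then obtain n where n: "\<And>x. (bracket e ^^ n) x = 0"
    using weight_shift_nilpotent[OF endo_bracket endo_bracket _ e(2)] by metis
  have ne: "\<exists>x\<in>S. \<exists>y\<in>S. trace_form B x y \<noteq> 0"
    using trace_form_nonzero[OF S simple_perfect[OF simple] B h0 c e] .
  obtain h f where "bracket h e = 2 *s e" "bracket h f = (-2) *s f" "bracket e f = h"
    using jacobson_morozov[OF S B simple_trace_form_nondegenerate[OF simple B ne] eS n] by blast
  then have "sl2_triple smul Basis bracket e h f" by unfold_locales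
  then show ?thesis using that eS e0 by blast
qed

text \<open>Both the isotropic part and the radical are spans, so by bilinearity it is enough to look at one simple
factor and one solvable ideal at a time.\<close>

lemma M_decomposedI:
  assumes "\<And>S I x y. simple S \<Longrightarrow> isotropic S \<Longrightarrow> ideal_of I UNIV \<Longrightarrow> solvable I \<Longrightarrow>
    x \<in> S \<Longrightarrow> y \<in> I \<Longrightarrow> bracket x y = 0"
  shows "M_decomposed s"
proof -
  define \<S> where "\<S> = \<Union>{S. ideal_of S s \<and> simple S \<and> isotropic S}"
  define \<I> where "\<I> = \<Union>{I. ideal_of I UNIV \<and> solvable I}"
  have zero: "bracket x y = 0" if "x \<in> \<S>" "y \<in> \<I>" for x y
    using assms that unfolding \<S>_def \<I>_def by blast
  have right: "bracket x y = 0" if "x \<in> \<S>" "y \<in> span \<I>" for x y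
    using pair.linear_eq_0_on_span[OF endo_bracket, of \<I> x y] zero that by blast
  have both: "bracket x y = 0" if "x \<in> span \<S>" "y \<in> span \<I>" for x y
    using pair.linear_eq_0_on_span[OF endo_bracket_left, of \<S> y x] right that by blast
  have "bracket_span (span \<S>) (span \<I>) \<subseteq> {0}"
    unfolding bracket_span_def using both by (intro span_minimal) auto
  moreover have "0 \<in> bracket_span (span \<S>) (span \<I>)"
    unfolding bracket_span_def by (rule span_zero)
  ultimately show "M_decomposed s"
    unfolding M_decomposed_def isotropic_part_def radical_def \<S>_def \<I>_def by blast
qed

end

theorem proposition1p9:
  fixes smul :: "'k::field_char_0 \<Rightarrow> 'v::ab_group_add \<Rightarrow> 'v"
    and bracket :: "'v \<Rightarrow> 'v \<Rightarrow> 'v"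
    and Basis s :: "'v set"
  assumes "finite_dimensional_vector_space smul Basis"
    and "lie_algebra smul bracket"
    and "lie_algebra.levi_factor smul bracket s"
    and "\<not> lie_algebra.M_decomposed smul bracket s"
  shows "\<exists>h n. lie_algebra.subalgebra smul bracket h \<and> n \<ge> 2 \<and>
           (iso_sl2_v smul bracket h n \<or>
            \<comment> \<open>\<open>h\<^sub>2\<^sub>n\<^sub>-\<^sub>1 = h\<^sub>2\<^sub>m\<^sub>+\<^sub>1\<close> for \<open>m = n - 1\<close>\<close>
            iso_sl2_heisenberg smul bracket h (n - 1))"
proof -
  interpret char0_lie_algebra smul Basis bracket
    unfolding char0_lie_algebra_def char0_space_def using assms(1,2) by blast
  obtain S I x y where S: "simple S" "isotropic S" and I: "ideal_of I UNIV" "solvable I"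
    and xy: "x \<in> S" "y \<in> I" "bracket x y \<noteq> 0"
    using M_decomposedI assms(4) by blast
  obtain e h f where e: "e \<in> S" "e \<noteq> 0" and triple: "sl2_triple smul Basis bracket e h f"
    using sl2_triple_of_isotropic[OF S] by metis
  have "\<exists>z\<in>I. bracket e z \<noteq> 0"
  proof (rule ccontr)
    assume "\<not> ?thesis"
    then have "e = 0"
      using simple_centralizer[OF S(1) _ xy e(1)] I(1) unfolding ideal_of_def by blast
    then show False using e(2) by simp
  qed
  then obtain z where "z \<in> I" "bracket e z \<noteq> 0" by blast
  then show ?thesis using sl2_triple.subalgebra_of_nontrivial_action[OF triple I] by blast
qed

end
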